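(* For every knot $K$, $2\pi\, psb[K] \le (\kappa+\tau)[K]$.
   Context: $[K]$ denotes the isotopy class (knot type) of a knot in $\mathbb{R}^3$; a conformation is a simple closed curve $K\subset\mathbb{R}^3$ representing it. For a unit vector $v \in S^2$, $P_v(K)$ is the orthogonal projection of $K$ onto the plane $P$ orthogonal to $v$. For a unit vector $w \in S^1 \subset P$, $\mu(w, P_v(K))$ is the number of local maxima of the projection with respect to the direction $w$, i.e. of the function $t \mapsto K(t)\cdot w$ (a maximal interval on which the function is constant and locally maximal counts once). The projective superbridge index is $$psb[K] = \min_{K\in[K]} \min_{v\in S^2} \max_{w\in S^1\subset v^\perp} \mu(w,P_v(K)),$$ where the outer minimum is over all conformations $K$ of the knot type. Milnor's curvature-torsion invariant is $$(\kappa+\tau)[K] = \inf_{K\in[K]} \int_K (\kappa + |\tau|)\,ds,$$ the infimum being over smooth conformations with nowhere vanishing curvature (so that the torsion $\tau$ is defined), where $\kappa$ is curvature and $s$ is arc length. *)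

theory Defs
  imports "HOL-Analysis.Analysis"
begin

text \<open>
  Closed curves are maps from the unit circle \<^term>\<open>sphere (0::complex) 1\<close> to \<open>\<real>\<^sup>3\<close>; the values off
  the circle are irrelevant to every notion below.
\<close>

type_synonym closed_curve = "complex \<Rightarrow> real^3"

abbreviation circle :: "complex set" where
  "circle \<equiv> sphere 0 1"

definition simple_closed_curve :: "closed_curve \<Rightarrow> bool" where
  "simple_closed_curve \<gamma> \<longleftrightarrow> continuous_on circle \<gamma> \<and> inj_on \<gamma> circle"

definition ambient_isotopic :: "(real^3) set \<Rightarrow> (real^3) set \<Rightarrow> bool" where
  "ambient_isotopic A B \<longleftrightarrow>
     (\<exists>H :: real \<Rightarrow> real^3 \<Rightarrow> real^3.
        continuous_on ({0..1} \<times> UNIV) (\<lambda>(t, x). H t x) \<and>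
        (\<forall>t\<in>{0..1}. \<exists>G. homeomorphism UNIV UNIV (H t) G) \<and>
        (\<forall>x. H 0 x = x) \<and>
        H 1 ` A = B)"

text \<open>
  The knot type is the class of unoriented knots: only the images of the curves are compared.
  Mirror images are not identified, since an ambient isotopy starts at the identity.
\<close>

definition knot_type :: "closed_curve \<Rightarrow> closed_curve set" where
  "knot_type \<gamma> =
     {\<delta>. simple_closed_curve \<delta> \<and> ambient_isotopic (\<gamma> ` circle) (\<delta> ` circle)}"


subsection \<open>Projective superbridge index\<close>

definition proj :: "real^3 \<Rightarrow> real^3 \<Rightarrow> real^3" where
  "proj v x = x - (x \<bullet> v) *\<^sub>R v"

text \<open>
  The components of the level sets are the maximal arcs (possibly points, possibly the whole circle)
  on which \<open>z \<mapsto> \<gamma> z \<bullet> w\<close> is constant. Such an arc is a local maximum if all of its points, in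
  particular its end points, are.
\<close>

definition local_max_arcs :: "real^3 \<Rightarrow> closed_curve \<Rightarrow> complex set set" where
  "local_max_arcs w \<gamma> =
     {A. \<exists>c. A \<in> components {z \<in> circle. \<gamma> z \<bullet> w = c} \<and>
             (\<forall>a\<in>A. eventually (\<lambda>z. \<gamma> z \<bullet> w \<le> c) (at a within circle))}"

definition num_local_max :: "real^3 \<Rightarrow> closed_curve \<Rightarrow> enat" where
  "num_local_max w \<gamma> =
     (if finite (local_max_arcs w \<gamma>) then enat (card (local_max_arcs w \<gamma>)) else \<infinity>)"

text \<open>
  In \<^typ>\<open>enat\<close> every infimum over a nonempty set is attained, and so is every supremum over a nonempty
  set that is finite; hence these are the minima and the maximum of the usual definition, where
  the maximum is \<open>\<infinity>\<close> if the number of local maxima is infinite or unbounded in \<open>w\<close>.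
\<close>

definition psb :: "closed_curve set \<Rightarrow> enat" where
  "psb T =
     (INF \<gamma>\<in>T. INF v\<in>sphere 0 1. SUP w\<in>{w \<in> sphere 0 1. w \<bullet> v = 0}.
        num_local_max w (proj v \<circ> \<gamma>))"


subsection \<open>Curvature and torsion\<close>

definition vderiv :: "(real \<Rightarrow> real^3) \<Rightarrow> real \<Rightarrow> real^3" where
  "vderiv f t = vector_derivative f (at t)"

definition smooth :: "(real \<Rightarrow> real^3) \<Rightarrow> bool" where
  "smooth f \<longleftrightarrow> (\<forall>n t. (vderiv ^^ n) f differentiable at t)"

text \<open>
  The Frenet frame of a regular, not necessarily unit speed, curve \<open>f\<close>; derivatives with respect to
  arc length are derivatives with respect to the parameter divided by \<open>norm (vderiv f t)\<close>.
\<close>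

definition unit_tangent :: "(real \<Rightarrow> real^3) \<Rightarrow> real \<Rightarrow> real^3" where
  "unit_tangent f t = vderiv f t /\<^sub>R norm (vderiv f t)"

definition curvature :: "(real \<Rightarrow> real^3) \<Rightarrow> real \<Rightarrow> real" where
  "curvature f t = norm (vderiv (unit_tangent f) t) / norm (vderiv f t)"

definition principal_normal :: "(real \<Rightarrow> real^3) \<Rightarrow> real \<Rightarrow> real^3" where
  "principal_normal f t =
     vderiv (unit_tangent f) t /\<^sub>R norm (vderiv (unit_tangent f) t)"

definition binormal :: "(real \<Rightarrow> real^3) \<Rightarrow> real \<Rightarrow> real^3" where
  "binormal f t = cross3 (unit_tangent f t) (principal_normal f t)"

definition torsion :: "(real \<Rightarrow> real^3) \<Rightarrow> real \<Rightarrow> real" where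
  "torsion f t = - (vderiv (binormal f) t \<bullet> principal_normal f t) / norm (vderiv f t)"

definition frenet_curve :: "(real \<Rightarrow> real^3) \<Rightarrow> bool" where
  "frenet_curve f \<longleftrightarrow> smooth f \<and> (\<forall>t. vderiv f t \<noteq> 0) \<and> (\<forall>t. curvature f t \<noteq> 0)"

text \<open>
  A closed curve \<open>\<gamma>\<close> is differentiated through its \<open>2\<pi>\<close>-periodic lift \<open>\<gamma> \<circ> cis\<close>. The infimum is taken
  in \<^typ>\<open>ereal\<close>, so it is \<open>\<infinity>\<close> if the knot type has no smooth representative at all (wild knots).
\<close>

definition curvature_torsion :: "closed_curve set \<Rightarrow> ereal" where
  "curvature_torsion T =
     (INF \<gamma>\<in>{\<gamma> \<in> T. frenet_curve (\<gamma> \<circ> cis)}.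
        ereal (integral {0..2 * pi}
          (\<lambda>t. (curvature (\<gamma> \<circ> cis) t + \<bar>torsion (\<gamma> \<circ> cis) t\<bar>) * norm (vderiv (\<gamma> \<circ> cis) t))))"

end

theory Submission
  imports Defs
begin

text \<open>
  Project a closed curve with unit tangent \<open>T\<close> and unit binormal \<open>B\<close> along a unit vector \<open>v\<close>, and let
  \<open>\<theta>\<close> be the angle of the projected tangent. Then \<open>\<theta>'\<close> has the sign of \<open>B \<bullet> v\<close>. If the height function
  in a direction \<open>w\<close> orthogonal to \<open>v\<close> has \<open>m\<close> local maxima, the curve splits into \<open>2m\<close> arcs on each of
  which \<open>T \<bullet> w\<close> vanishes at two points and is nonzero between them. On such an excursion either the
  total variation of \<open>\<theta>\<close> is at least \<open>\<pi>\<close>, or \<open>\<theta>\<close> returns to its initial value, so that \<open>B \<bullet> v\<close>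
  changes sign. Hence \<open>2\<pi>m\<close> is at most the total variation of \<open>\<theta>\<close> plus \<open>\<pi>\<close> times the number of sign
  changes of \<open>B \<bullet> v\<close>, a bound that does not depend on \<open>w\<close>. By Crofton-type formulas its average over
  \<open>v\<close> is at most the integral of \<open>\<kappa> + \<bar>\<tau>\<bar>\<close>, so some \<open>v\<close> works.

  The sign changes of \<open>B \<bullet> v\<close> are counted by the total variation of \<open>arctan (k * (B \<bullet> v))\<close> as \<open>k \<rightarrow> \<infinity>\<close>,
  and the limit is exchanged with the average by Fatou's lemma. The average is taken over the unit
  ball rather than the sphere; the constants in the averages follow from rotation invariance, by
  comparison with a great circle.
\<close>

subsection \<open>Excursions of planar curves\<close>

lemma has_real_derivative_Im_Ln_Complex:
  fixes x y :: "real \<Rightarrow> real"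
  assumes "(x has_real_derivative x') (at t)" "(y has_real_derivative y') (at t)"
    and "Complex (x t) (y t) \<notin> \<real>\<^sub>\<le>\<^sub>0"
  shows "((\<lambda>t. Im (Ln (Complex (x t) (y t)))) has_real_derivative
      (x t * y' - y t * x') / ((x t)\<^sup>2 + (y t)\<^sup>2)) (at t)"
proof -
  let ?p = "\<lambda>t. Complex (x t) (y t)"
  have "(?p has_vector_derivative Complex x' y') (at t)"
    using assms by (simp add: has_vector_derivative_complex_iff)
  then have "((Ln \<circ> ?p) has_vector_derivative Complex x' y' * inverse (?p t)) (at t)"
    by (rule field_vector_diff_chain_at) (rule has_field_derivative_Ln [OF assms(3)])
  then have "((\<lambda>t. Im (Ln (?p t))) has_real_derivative Im (Complex x' y' * inverse (?p t))) (at t)"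
    by (auto simp: has_vector_derivative_complex_iff)
  moreover have "Im (Complex x' y' * inverse (?p t)) = (x t * y' - y t * x') / ((x t)\<^sup>2 + (y t)\<^sup>2)"
    by (simp add: diff_divide_distrib mult.commute)
  ultimately show ?thesis
    by simp
qed

lemma Im_Ln_Complex_half_plane:
  assumes "Complex x y \<noteq> 0" "x \<ge> 0"
  shows "Im (Ln (Complex x y)) = (if x > 0 then arctan (y / x) else if y > 0 then pi / 2 else - (pi / 2))"
  using assms by (subst Im_Ln_eq) auto

lemma half_plane_not_nonpos_Reals:
  assumes "Complex x y \<noteq> 0" "x \<ge> 0"
  shows "Complex x y \<notin> \<real>\<^sub>\<le>\<^sub>0"
  using assms by (auto simp: complex_nonpos_Reals_iff complex_eq_iff)

text \<open>The closed right half plane without the origin avoids the slit of \<open>Ln\<close>, so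
  a single branch of the angle serves on the whole interval.\<close>

lemma half_plane_angle_integral:
  fixes x y x' y' :: "real \<Rightarrow> real"
  assumes "a \<le> b"
    and "\<And>t. t \<in> {a..b} \<Longrightarrow> (x has_real_derivative x' t) (at t)"
    and "\<And>t. t \<in> {a..b} \<Longrightarrow> (y has_real_derivative y' t) (at t)"
    and "\<And>t. t \<in> {a..b} \<Longrightarrow> x t \<ge> 0"
    and "\<And>t. t \<in> {a..b} \<Longrightarrow> Complex (x t) (y t) \<noteq> 0"
  shows "((\<lambda>t. (x t * y' t - y t * x' t) / ((x t)\<^sup>2 + (y t)\<^sup>2)) has_integral
      Im (Ln (Complex (x b) (y b))) - Im (Ln (Complex (x a) (y a)))) {a..b}"
proof (rule fundamental_theorem_of_calculus [OF assms(1)])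
  fix t assume t: "t \<in> {a..b}"
  show "((\<lambda>t. Im (Ln (Complex (x t) (y t)))) has_vector_derivative
      (x t * y' t - y t * x' t) / ((x t)\<^sup>2 + (y t)\<^sup>2)) (at t within {a..b})"
    unfolding has_real_derivative_iff_has_vector_derivative [symmetric]
    by (rule has_field_derivative_at_within, rule has_real_derivative_Im_Ln_Complex)
      (use assms t half_plane_not_nonpos_Reals in auto)
qed

text \<open>At both ends the curve lies on the imaginary axis, where the angle is pi/2 or -pi/2; in
  between the angle is strictly smaller in absolute value. If the end values differ, the total
  variation is at least pi. If they agree, the angle leaves this value and returns to it, so it is
  not monotone and \<open>D\<close> takes both signs.\<close>

lemma half_plane_excursion:
  fixes x y x' y' :: "real \<Rightarrow> real"
  defines "D \<equiv> \<lambda>t. (x t * y' t - y t * x' t) / ((x t)\<^sup>2 + (y t)\<^sup>2)"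
  assumes ab: "a < b"
    and x: "\<And>t. t \<in> {a..b} \<Longrightarrow> (x has_real_derivative x' t) (at t)"
    and y: "\<And>t. t \<in> {a..b} \<Longrightarrow> (y has_real_derivative y' t) (at t)"
    and D: "continuous_on {a..b} D"
    and ends: "x a = 0" "x b = 0"
    and pos: "\<And>t. t \<in> {a<..<b} \<Longrightarrow> x t > 0"
    and nz: "\<And>t. t \<in> {a..b} \<Longrightarrow> x t \<noteq> 0 \<or> y t \<noteq> 0"
  shows "pi \<le> integral {a..b} (\<lambda>t. \<bar>D t\<bar>) \<or> (\<exists>s\<in>{a..b}. \<exists>t\<in>{a..b}. D s < 0 \<and> 0 < D t)"
proof -
  define \<theta> where "\<theta> t = Im (Ln (Complex (x t) (y t)))" for t
  have p: "x t \<ge> 0" "Complex (x t) (y t) \<noteq> 0" if "t \<in> {a..b}" for t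
  proof -
    show "x t \<ge> 0"
      using that pos [of t] ends by (cases "t = a"; cases "t = b") auto
    show "Complex (x t) (y t) \<noteq> 0"
      using nz [OF that] by (auto simp: complex_eq_iff)
  qed
  have \<theta>': "(\<theta> has_real_derivative D t) (at t)" if "t \<in> {a..b}" for t
    unfolding \<theta>_def [abs_def] D_def
    by (rule has_real_derivative_Im_Ln_Complex
        [OF x [OF that] y [OF that] half_plane_not_nonpos_Reals [OF p(2) [OF that] p(1) [OF that]]])
  have int: "(D has_integral \<theta> b - \<theta> a) {a..b}"
    unfolding \<theta>_def D_def by (rule half_plane_angle_integral) (use ab x y p in simp_all)
  have abs: "\<bar>\<theta> b - \<theta> a\<bar> \<le> integral {a..b} (\<lambda>t. \<bar>D t\<bar>)"
  proof -
    have "norm (integral {a..b} D) \<le> integral {a..b} (\<lambda>t. \<bar>D t\<bar>)"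
      by (rule integral_norm_bound_integral) (use int D in \<open>auto intro!: integrable_continuous_interval continuous_on_rabs\<close>)
    then show ?thesis
      using int by (simp add: integral_unique)
  qed
  define c where "c = (a + b) / 2"
  have c: "a < c" "c < b"
    using ab by (auto simp: c_def)
  have in_ab: "a \<in> {a..b}" "b \<in> {a..b}" "c \<in> {a..b}"
    using ab c by auto
  have "\<theta> c = arctan (y c / x c)"
    using p [of c] pos [of c] c by (simp add: \<theta>_def Im_Ln_Complex_half_plane)
  then have \<theta>c: "- (pi / 2) < \<theta> c" "\<theta> c < pi / 2"
    using arctan_bounded [of "y c / x c"] by auto
  have \<theta>_end: "\<theta> t = pi / 2 \<or> \<theta> t = - (pi / 2)" if "t \<in> {a..b}" "x t = 0" for t
    using Im_Ln_Complex_half_plane [of "x t" "y t"] p [OF that(1)] that(2)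
    by (cases "y t > 0") (auto simp: \<theta>_def)
  note \<theta>_ends = \<theta>_end [OF in_ab(1) ends(1)] \<theta>_end [OF in_ab(2) ends(2)]
  show ?thesis
  proof (cases "\<theta> a = \<theta> b")
    case False
    then show ?thesis
      using \<theta>_ends abs pi_gt_zero by auto
  next
    case True
    have "\<not> (\<forall>t\<in>{a..b}. 0 \<le> D t)"
    proof
      assume sign: "\<forall>t\<in>{a..b}. 0 \<le> D t"
      have "\<theta> u \<le> \<theta> v" if "a \<le> u" "u \<le> v" "v \<le> b" for u v
      proof (rule DERIV_nonneg_imp_nondecreasing [OF that(2)])
        fix t assume "u \<le> t" "t \<le> v"
        then have "t \<in> {a..b}"
          using that by simp
        then show "\<exists>y. (\<theta> has_real_derivative y) (at t) \<and> 0 \<le> y"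
          using \<theta>' sign by blast
      qed
      then have "\<theta> a \<le> \<theta> c" "\<theta> c \<le> \<theta> b"
        using c by auto
      then show False
        using True \<theta>c \<theta>_ends by auto
    qed
    moreover have "\<not> (\<forall>t\<in>{a..b}. D t \<le> 0)"
    proof
      assume sign: "\<forall>t\<in>{a..b}. D t \<le> 0"
      have "\<theta> v \<le> \<theta> u" if "a \<le> u" "u \<le> v" "v \<le> b" for u v
      proof (rule DERIV_nonpos_imp_nonincreasing [OF that(2)])
        fix t assume "u \<le> t" "t \<le> v"
        then have "t \<in> {a..b}"
          using that by simp
        then show "\<exists>y. (\<theta> has_real_derivative y) (at t) \<and> y \<le> 0"
          using \<theta>' sign by blast
      qed
      then have "\<theta> c \<le> \<theta> a" "\<theta> b \<le> \<theta> c"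
        using c by auto
      then show False
        using True \<theta>c \<theta>_ends by auto
    qed
    ultimately obtain s t where st: "s \<in> {a..b}" "t \<in> {a..b}" and "\<not> 0 \<le> D s" "\<not> D t \<le> 0"
      by auto
    then have "D s < 0" "0 < D t"
      by linarith+
    with st show ?thesis
      by blast
  qed
qed

text \<open>The zero sets on both sides of \<open>r\<close> are compact, so there is a last zero
  \<open>a\<close> before \<open>r\<close> and a first zero \<open>b\<close> after it.\<close>

lemma zeros_around_nonzero:
  fixes x :: "real \<Rightarrow> real"
  assumes cont: "continuous_on {\<alpha>..\<beta>} x" and "x \<alpha> = 0" "x \<beta> = 0" "r \<in> {\<alpha>..\<beta>}" "x r \<noteq> 0"
  obtains a b where "\<alpha> \<le> a" "a < b" "b \<le> \<beta>" "x a = 0" "x b = 0" "\<And>t. t \<in> {a<..<b} \<Longrightarrow> x t \<noteq> 0"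
proof -
  let ?Z = "\<lambda>c d. {t \<in> {c..d}. x t = 0}"
  have "compact (?Z c d)" if "{c..d} \<subseteq> {\<alpha>..\<beta>}" for c d
  proof -
    have "closed (?Z c d)"
      by (rule continuous_closed_preimage_constant [OF continuous_on_subset [OF cont that]]) simp
    moreover have "bounded (?Z c d)"
      by (rule bounded_subset [of "{c..d}"]) auto
    ultimately show ?thesis
      by (simp add: compact_eq_bounded_closed)
  qed
  then have "compact (?Z \<alpha> r)" "compact (?Z r \<beta>)"
    using assms by auto
  moreover have "?Z \<alpha> r \<noteq> {}" "?Z r \<beta> \<noteq> {}"
    using assms by auto
  ultimately obtain a b where a: "a \<in> ?Z \<alpha> r" "\<forall>t\<in>?Z \<alpha> r. t \<le> a"
    and b: "b \<in> ?Z r \<beta>" "\<forall>t\<in>?Z r \<beta>. b \<le> t"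
    using compact_attains_sup [of "?Z \<alpha> r"] compact_attains_inf [of "?Z r \<beta>"] by blast
  show thesis
  proof
    show "\<alpha> \<le> a" "b \<le> \<beta>" "x a = 0" "x b = 0"
      using a b by auto
    have "a \<noteq> r" "b \<noteq> r"
      using a b assms by auto
    then show "a < b"
      using a b by auto
    show "x t \<noteq> 0" if "t \<in> {a<..<b}" for t
    proof
      assume "x t = 0"
      then have "t \<in> ?Z \<alpha> r \<or> t \<in> ?Z r \<beta>"
        using that a(1) b(1) by auto
      then show False
        using that a(2) b(2) by auto
    qed
  qed
qed

text \<open>The integrand is the absolute derivative of \<open>arctan (k * s t)\<close>, so its
  integral is a total variation and dominates the change between any two points. If \<open>s\<close>
  takes both signs, this change tends to pi as \<open>k\<close> grows.\<close>

lemma arctan_integral_swing: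
  fixes s s' :: "real \<Rightarrow> real"
  assumes "a \<le> b"
    and s: "\<And>t. t \<in> {a..b} \<Longrightarrow> (s has_real_derivative s' t) (at t)"
    and s': "continuous_on {a..b} s'"
    and k: "0 \<le> k" and uv: "u \<in> {a..b}" "v \<in> {a..b}"
  shows "\<bar>arctan (k * s v) - arctan (k * s u)\<bar> \<le> integral {a..b} (\<lambda>t. k * \<bar>s' t\<bar> / (1 + (k * s t)\<^sup>2))"
  using uv
proof (induction u v rule: linorder_wlog)
  case (sym u v)
  then show ?case by (simp add: abs_minus_commute)
next
  case (le u v)
  have cs: "continuous_on {a..b} s"
    by (meson s DERIV_continuous continuous_at_imp_continuous_on)
  have pos: "1 + (k * s t)\<^sup>2 \<noteq> 0" for t
    by (smt (verit) zero_le_power2)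
  have sub: "{u..v} \<subseteq> {a..b}"
    using le by auto
  have cont: "continuous_on {a..b} (\<lambda>t. k * s' t / (1 + (k * s t)\<^sup>2))"
    "continuous_on {a..b} (\<lambda>t. k * \<bar>s' t\<bar> / (1 + (k * s t)\<^sup>2))"
    using cs s' pos by (auto intro!: continuous_intros)
  have *: "((\<lambda>t. k * s' t / (1 + (k * s t)\<^sup>2)) has_integral arctan (k * s v) - arctan (k * s u)) {u..v}"
  proof (rule fundamental_theorem_of_calculus)
    fix t assume "t \<in> {u..v}"
    then have "((\<lambda>t. arctan (k * s t)) has_real_derivative k * s' t / (1 + (k * s t)\<^sup>2)) (at t)"
      using s sub by (auto intro!: derivative_eq_intros simp: divide_inverse)
    then show "((\<lambda>t. arctan (k * s t)) has_vector_derivative k * s' t / (1 + (k * s t)\<^sup>2)) (at t within {u..v})"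
      by (simp add: has_field_derivative_at_within has_real_derivative_iff_has_vector_derivative [symmetric])
  qed (use le in auto)
  then have "(\<lambda>t. k * s' t / (1 + (k * s t)\<^sup>2)) integrable_on {u..v}"
    by (rule has_integral_integrable)
  moreover have "(\<lambda>t. k * \<bar>s' t\<bar> / (1 + (k * s t)\<^sup>2)) integrable_on {u..v}"
    by (rule integrable_continuous_interval [OF continuous_on_subset [OF cont(2) sub]])
  ultimately have "norm (integral {u..v} (\<lambda>t. k * s' t / (1 + (k * s t)\<^sup>2)))
      \<le> integral {u..v} (\<lambda>t. k * \<bar>s' t\<bar> / (1 + (k * s t)\<^sup>2))"
    using k by (intro integral_norm_bound_integral) (auto simp: abs_mult)
  then have "\<bar>arctan (k * s v) - arctan (k * s u)\<bar> \<le> integral {u..v} (\<lambda>t. k * \<bar>s' t\<bar> / (1 + (k * s t)\<^sup>2))"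
    using * by (simp add: integral_unique)
  also have "\<dots> \<le> integral {a..b} (\<lambda>t. k * \<bar>s' t\<bar> / (1 + (k * s t)\<^sup>2))"
    using sub k integrable_continuous_interval [OF cont(2)]
      integrable_continuous_interval [OF continuous_on_subset [OF cont(2) sub]]
    by (intro integral_subset_le) auto
  finally show ?case .
qed

subsection \<open>Excursions of the projected tangent\<close>

text \<open>The right side is the Gram determinant of \<open>a\<close>, \<open>u\<close>,
  \<open>w\<close>, which is the square of their determinant.\<close>

lemma Gram_cross3:
  fixes a u w :: "real^3"
  shows "(a \<bullet> cross3 u w)\<^sup>2 = (a \<bullet> a) * (u \<bullet> u) * (w \<bullet> w) + 2 * (a \<bullet> u) * (u \<bullet> w) * (a \<bullet> w)
    - (a \<bullet> a) * (u \<bullet> w)\<^sup>2 - (u \<bullet> u) * (a \<bullet> w)\<^sup>2 - (w \<bullet> w) * (a \<bullet> u)\<^sup>2"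
  by (simp add: cross3_def inner_vec_def sum_3 vector_def) algebra

text \<open>Both sides are the inner product of \<open>cross3 a b\<close> with
  \<open>cross3 w (cross3 u w)\<close>, expanded by the Binet-Cauchy identity on the left and by the
  double cross product formula on the right. For \<open>a = T t\<close> and \<open>b = T' t\<close>
  the left side is the numerator of the derivative of the projected tangent angle.\<close>

lemma cross3_minor:
  fixes a b u w :: "real^3"
  shows "(a \<bullet> w) * (b \<bullet> cross3 u w) - (a \<bullet> cross3 u w) * (b \<bullet> w)
    = (w \<bullet> w) * (cross3 a b \<bullet> u) - (u \<bullet> w) * (cross3 a b \<bullet> w)"
  by (simp add: cross3_def inner_vec_def sum_3 vector_def) algebra

text \<open>The parameter is arbitrary: \<open>norm (T' t)\<close> and \<open>norm (B' t)\<close>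
  play the role of curvature and absolute torsion times speed. That \<open>B\<close> is the binormal
  is encoded by the cross product of \<open>T\<close> with its derivative, without a principal
  normal.\<close>

locale unit_frame =
  fixes T B T' B' :: "real \<Rightarrow> real^3"
  assumes has_derivative_T: "\<And>t. (T has_vector_derivative T' t) (at t)"
    and has_derivative_B: "\<And>t. (B has_vector_derivative B' t) (at t)"
    and continuous_T': "continuous_on UNIV T'"
    and continuous_B': "continuous_on UNIV B'"
    and norm_T: "\<And>t. norm (T t) = 1"
    and norm_B: "\<And>t. norm (B t) = 1"
    and cross_T_T': "\<And>t. cross3 (T t) (T' t) = norm (T' t) *\<^sub>R B t"
    and T'_nonzero: "\<And>t. T' t \<noteq> 0"
begin

text \<open>
  The density of the total variation of \<open>\<theta>\<close>, the angle of the tangent projected along \<open>v\<close>; and that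
  of \<open>arctan (k * (B \<bullet> v))\<close>.
\<close>

definition turning_density :: "real^3 \<Rightarrow> real \<Rightarrow> real" where
  "turning_density v t = norm (T' t) * (\<bar>B t \<bullet> v\<bar> * norm v / ((norm v)\<^sup>2 - (T t \<bullet> v)\<^sup>2))"

definition swing_density :: "real \<Rightarrow> real^3 \<Rightarrow> real \<Rightarrow> real" where
  "swing_density k v t = k * \<bar>B' t \<bullet> v\<bar> / (1 + (k * (B t \<bullet> v))\<^sup>2)"

text \<open>As \<open>T t\<close> is a unit vector, equality would make \<open>v\<close> a multiple
  of \<open>T t\<close>. So no tangent projects to zero along \<open>v\<close>, and the denominator
  in \<open>turning_density\<close> never vanishes.\<close>

definition transversal :: "real^3 \<Rightarrow> bool" where
  "transversal v \<longleftrightarrow> (\<forall>t. (norm v)\<^sup>2 \<noteq> (T t \<bullet> v)\<^sup>2)"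

lemma continuous_T: "continuous_on S T" and continuous_B: "continuous_on S B"
  using has_vector_derivative_continuous [OF has_derivative_T] has_vector_derivative_continuous [OF has_derivative_B]
  by (simp_all add: continuous_at_imp_continuous_on)

lemma T_dot_le: "(T t \<bullet> v)\<^sup>2 \<le> (norm v)\<^sup>2"
  using Cauchy_Schwarz_ineq2 [of "T t" v] by (simp add: norm_T abs_le_square_iff [symmetric])

lemma turning_density_nonneg: "0 \<le> turning_density v t"
  using T_dot_le [of t v] by (simp add: turning_density_def)

lemma swing_density_nonneg: "0 \<le> k \<Longrightarrow> 0 \<le> swing_density k v t"
  by (simp add: swing_density_def)

lemma continuous_turning_density: "transversal v \<Longrightarrow> continuous_on S (turning_density v)"
  unfolding turning_density_def [abs_def] transversal_def
  by (intro continuous_intros continuous_T continuous_B continuous_on_subset [OF continuous_T']) auto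

lemma continuous_swing_density: "continuous_on S (swing_density k v)"
proof -
  have "1 + (k * (B t \<bullet> v))\<^sup>2 \<noteq> 0" for t
    by (smt (verit) zero_le_power2)
  then show ?thesis
    unfolding swing_density_def [abs_def]
    by (intro continuous_intros continuous_B continuous_on_subset [OF continuous_B']) auto
qed

text \<open>The unit vector \<open>u\<close> along \<open>v\<close>, the direction \<open>w\<close>
  and \<open>e\<close> form an orthonormal basis, and \<open>T \<bullet> w\<close>,
  \<open>T \<bullet> e\<close> are the coordinates of the projected tangent. The derivative of its
  angle is a positive factor times \<open>B \<bullet> v\<close>, so the planar dichotomy
  applies.\<close>

lemma excursion_or_binormal_sign_change:
  assumes v: "transversal v" and w: "norm w = 1" "w \<bullet> v = 0"
    and "a < b" "T a \<bullet> w = 0" "T b \<bullet> w = 0" "\<And>t. t \<in> {a<..<b} \<Longrightarrow> 0 < T t \<bullet> w"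
  shows "pi \<le> integral {a..b} (turning_density v) \<or> (\<exists>s\<in>{a..b}. \<exists>t\<in>{a..b}. B s \<bullet> v < 0 \<and> 0 < B t \<bullet> v)"
proof -
  define u where "u = v /\<^sub>R norm v"
  define e where "e = cross3 u w"
  have vnz: "norm v > 0"
    using v T_dot_le [of 0 v] by (auto simp: transversal_def)
  have u: "u \<bullet> u = 1" "u \<bullet> w = 0"
    using vnz w(2) by (simp_all add: u_def dot_square_norm power2_eq_square inner_commute)
  have w1: "w \<bullet> w = 1"
    using w by (simp add: dot_square_norm)
  have T1: "T t \<bullet> T t = 1" for t
    by (simp add: dot_square_norm norm_T)
  \<comment> \<open>For orthonormal \<open>u\<close> and \<open>w\<close> the Gram determinant
    reduces to Pythagoras: the squared components of \<open>T t\<close> along \<open>u\<close>,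
    \<open>w\<close> and \<open>e\<close> add up to 1.\<close>
  have sumsq: "(T t \<bullet> w)\<^sup>2 + (T t \<bullet> e)\<^sup>2 = ((norm v)\<^sup>2 - (T t \<bullet> v)\<^sup>2) / (norm v)\<^sup>2" for t
    using Gram_cross3 [of "T t" u w] vnz
    by (simp add: e_def u w1 T1) (simp add: u_def field_simps)
  \<comment> \<open>The wedge of the projected \<open>T\<close> and \<open>T'\<close> is the
    component of their cross product along \<open>u\<close>, and this cross product is a multiple of
    \<open>B\<close>.\<close>
  have minor: "(T t \<bullet> w) * (T' t \<bullet> e) - (T t \<bullet> e) * (T' t \<bullet> w) = norm (T' t) * (B t \<bullet> v) / norm v" for t
    using cross3_minor [of "T t" w "T' t" u]
    by (simp add: e_def u w1 cross_T_T') (simp add: u_def divide_inverse)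
  have D: "((T t \<bullet> w) * (T' t \<bullet> e) - (T t \<bullet> e) * (T' t \<bullet> w)) / ((T t \<bullet> w)\<^sup>2 + (T t \<bullet> e)\<^sup>2)
      = norm (T' t) * ((B t \<bullet> v) * norm v / ((norm v)\<^sup>2 - (T t \<bullet> v)\<^sup>2))" for t
    unfolding sumsq minor using vnz by (simp add: power2_eq_square)
  have den: "0 < (norm v)\<^sup>2 - (T t \<bullet> v)\<^sup>2" for t
    using v T_dot_le [of t v] by (auto simp: transversal_def less_le)
  have "pi \<le> integral {a..b} (\<lambda>t. \<bar>norm (T' t) * ((B t \<bullet> v) * norm v / ((norm v)\<^sup>2 - (T t \<bullet> v)\<^sup>2))\<bar>)
     \<or> (\<exists>s\<in>{a..b}. \<exists>t\<in>{a..b}. norm (T' s) * ((B s \<bullet> v) * norm v / ((norm v)\<^sup>2 - (T s \<bullet> v)\<^sup>2)) < 0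
         \<and> 0 < norm (T' t) * ((B t \<bullet> v) * norm v / ((norm v)\<^sup>2 - (T t \<bullet> v)\<^sup>2)))"
  proof (rule half_plane_excursion [where x = "\<lambda>t. T t \<bullet> w" and y = "\<lambda>t. T t \<bullet> e"
        and x' = "\<lambda>t. T' t \<bullet> w" and y' = "\<lambda>t. T' t \<bullet> e", unfolded D])
    show "((\<lambda>t. T t \<bullet> w) has_real_derivative T' t \<bullet> w) (at t)" for t
      using bounded_linear.has_vector_derivative [OF bounded_linear_inner_left has_derivative_T]
      by (simp add: has_real_derivative_iff_has_vector_derivative)
    show "((\<lambda>t. T t \<bullet> e) has_real_derivative T' t \<bullet> e) (at t)" for t
      using bounded_linear.has_vector_derivative [OF bounded_linear_inner_left has_derivative_T]
      by (simp add: has_real_derivative_iff_has_vector_derivative)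
    show "continuous_on {a..b} (\<lambda>t. norm (T' t) * ((B t \<bullet> v) * norm v / ((norm v)\<^sup>2 - (T t \<bullet> v)\<^sup>2)))"
      using v by (intro continuous_intros continuous_T continuous_B continuous_on_subset [OF continuous_T'])
        (auto simp: transversal_def)
    show "T t \<bullet> w \<noteq> 0 \<or> T t \<bullet> e \<noteq> 0" for t
    proof -
      have "(T t \<bullet> w)\<^sup>2 + (T t \<bullet> e)\<^sup>2 > 0"
        unfolding sumsq using den [of t] vnz by simp
      then show ?thesis
        by auto
    qed
  qed (use assms in auto)
  moreover have "\<bar>norm (T' t) * ((B t \<bullet> v) * norm v / ((norm v)\<^sup>2 - (T t \<bullet> v)\<^sup>2))\<bar> = turning_density v t" for t
    using den [of t] by (simp add: turning_density_def abs_mult)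
  ultimately show ?thesis
    using den vnz by (simp add: mult_less_0_iff zero_less_mult_iff divide_less_0_iff zero_less_divide_iff T'_nonzero less_imp_le not_less)
      (smt (verit, best))
qed

text \<open>The index \<open>k\<close> is a natural number so that the densities form a sequence, to
  which Fatou's lemma can be applied.\<close>

definition total_density :: "nat \<Rightarrow> real^3 \<Rightarrow> real \<Rightarrow> real" where
  "total_density k v t = turning_density v t + swing_density (real k) v t"

lemma total_density_nonneg: "0 \<le> total_density k v t"
  by (simp add: total_density_def turning_density_nonneg swing_density_nonneg)

lemma continuous_total_density: "transversal v \<Longrightarrow> continuous_on S (total_density k v)"
  unfolding total_density_def [abs_def]
  by (intro continuous_intros continuous_turning_density continuous_swing_density)

text \<open>Either the turning part alone contributes pi, for every \<open>k\<close>, or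
  \<open>B \<bullet> v\<close> takes both signs and the swing of
  \<open>arctan (k * (B \<bullet> v))\<close> tends to pi. The loss \<open>\<delta>\<close> pays for
  stopping at a finite \<open>k\<close>.\<close>

lemma density_excursion:
  assumes v: "transversal v" and w: "norm w = 1" "w \<bullet> v = 0"
    and ab: "a < b" "T a \<bullet> w = 0" "T b \<bullet> w = 0" "\<And>t. t \<in> {a<..<b} \<Longrightarrow> T t \<bullet> w \<noteq> 0"
    and "0 < \<delta>"
  shows "\<forall>\<^sub>F k in sequentially. pi - \<delta> \<le> integral {a..b} (total_density k v)"
proof -
  have int: "turning_density v integrable_on {a..b}" "swing_density k v integrable_on {a..b}" for k
    using v by (auto intro!: integrable_continuous_interval continuous_turning_density continuous_swing_density)
  have split: "integral {a..b} (total_density k v)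
      = integral {a..b} (turning_density v) + integral {a..b} (swing_density (real k) v)" for k
    unfolding total_density_def [abs_def] by (rule integral_add [OF int])
  have nonneg: "0 \<le> integral {a..b} (turning_density v)" "0 \<le> integral {a..b} (swing_density (real k) v)" for k
    by (auto intro!: integral_nonneg int turning_density_nonneg swing_density_nonneg)
  have "pi \<le> integral {a..b} (turning_density v) \<or> (\<exists>s\<in>{a..b}. \<exists>t\<in>{a..b}. B s \<bullet> v < 0 \<and> 0 < B t \<bullet> v)"
  proof -
    \<comment> \<open>By connectedness \<open>T \<bullet> w\<close> has a constant sign inside the
      excursion.\<close>
    have "connected ((\<lambda>t. T t \<bullet> w) ` {a<..<b})"
      by (intro connected_continuous_image continuous_intros continuous_T) simp
    then have sign: "(\<forall>t\<in>{a<..<b}. 0 < T t \<bullet> w) \<or> (\<forall>t\<in>{a<..<b}. T t \<bullet> w < 0)"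
      using ab(4) unfolding connected_iff_interval by (smt (verit, best) image_iff)
    show ?thesis
    proof (cases "\<forall>t\<in>{a<..<b}. 0 < T t \<bullet> w")
      case True
      then show ?thesis
        using excursion_or_binormal_sign_change [OF v w ab(1-3)] by blast
    next
      case False
      then show ?thesis
        \<comment> \<open>A negative excursion in direction \<open>w\<close> is a positive one in
          the opposite direction, and the conclusion does not mention \<open>w\<close>.\<close>
        using excursion_or_binormal_sign_change [of v "- w" a b] v w ab sign by force
    qed
  qed
  then show ?thesis
  proof
    assume "pi \<le> integral {a..b} (turning_density v)"
    then show ?thesis
      using nonneg \<open>0 < \<delta>\<close> by (intro always_eventually) (smt (verit) split)
  next
    assume "\<exists>s\<in>{a..b}. \<exists>t\<in>{a..b}. B s \<bullet> v < 0 \<and> 0 < B t \<bullet> v"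
    then obtain s t where s: "s \<in> {a..b}" "B s \<bullet> v < 0" and t: "t \<in> {a..b}" "0 < B t \<bullet> v"
      by blast
    have "((\<lambda>k. arctan (real k * (B t \<bullet> v)) - arctan (real k * (B s \<bullet> v))) \<longlongrightarrow> pi / 2 - - (pi / 2)) sequentially"
    proof (intro tendsto_diff)
      have "filterlim (\<lambda>k. (B t \<bullet> v) * real k) at_top sequentially"
        by (rule filterlim_tendsto_pos_mult_at_top [OF tendsto_const t(2) filterlim_real_sequentially])
      then show "((\<lambda>k. arctan (real k * (B t \<bullet> v))) \<longlongrightarrow> pi / 2) sequentially"
        by (simp add: filterlim_compose [OF tendsto_arctan_at_top] mult.commute)
      have "filterlim (\<lambda>k. (B s \<bullet> v) * real k) at_bot sequentially"
        by (rule filterlim_tendsto_neg_mult_at_bot [OF tendsto_const s(2) filterlim_real_sequentially])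
      then show "((\<lambda>k. arctan (real k * (B s \<bullet> v))) \<longlongrightarrow> - (pi / 2)) sequentially"
        by (simp add: filterlim_compose [OF tendsto_arctan_at_bot] mult.commute)
    qed
    then have "\<forall>\<^sub>F k in sequentially. pi - \<delta> < arctan (real k * (B t \<bullet> v)) - arctan (real k * (B s \<bullet> v))"
      using \<open>0 < \<delta>\<close> by (intro order_tendstoD) auto
    then show ?thesis
    proof eventually_elim
      case (elim k)
      have "\<bar>arctan (real k * (B t \<bullet> v)) - arctan (real k * (B s \<bullet> v))\<bar> \<le> integral {a..b} (swing_density (real k) v)"
        unfolding swing_density_def [abs_def]
      proof (rule arctan_integral_swing [where s = "\<lambda>t. B t \<bullet> v" and s' = "\<lambda>t. B' t \<bullet> v"])
        show "((\<lambda>t. B t \<bullet> v) has_real_derivative B' t \<bullet> v) (at t)" for t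
          using bounded_linear.has_vector_derivative [OF bounded_linear_inner_left has_derivative_B]
          by (simp add: has_real_derivative_iff_has_vector_derivative)
        show "continuous_on {a..b} (\<lambda>t. B' t \<bullet> v)"
          by (intro continuous_intros continuous_on_subset [OF continuous_B']) auto
      qed (use s t ab in auto)
      then show ?case
        using elim nonneg(1) split [of k] by linarith
    qed
  qed
qed

end

subsection \<open>Local maxima of closed curves\<close>

text \<open>Projecting along \<open>u\<close> leaves heights in directions orthogonal to
  \<open>u\<close> unchanged, so the maxima can be counted on the space curve itself.\<close>

lemma local_max_arcs_proj:
  assumes "w \<bullet> u = 0"
  shows "local_max_arcs w (proj u \<circ> \<gamma>) = local_max_arcs w \<gamma>"
proof -
  have "proj u x \<bullet> w = x \<bullet> w" for x
    using assms by (simp add: proj_def inner_diff_left inner_commute [of u w])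
  then show ?thesis
    by (simp add: local_max_arcs_def)
qed

lemma local_max_arcs_disjoint:
  assumes "A \<in> local_max_arcs w \<gamma>" "A' \<in> local_max_arcs w \<gamma>" "z \<in> A" "z \<in> A'"
  shows "A = A'"
proof -
  obtain c c' where c: "A \<in> components {z \<in> circle. \<gamma> z \<bullet> w = c}" "A' \<in> components {z \<in> circle. \<gamma> z \<bullet> w = c'}"
    using assms by (auto simp: local_max_arcs_def)
  then have "c = \<gamma> z \<bullet> w" "c' = \<gamma> z \<bullet> w"
    using assms in_components_subset by fastforce+
  then show ?thesis
    using c assms components_nonoverlap by blast
qed

lemma local_max_arcs_eventually_le:
  assumes "A \<in> local_max_arcs w \<gamma>" "cis s \<in> A"
  shows "\<forall>\<^sub>F t in nhds s. \<gamma> (cis t) \<bullet> w \<le> \<gamma> (cis s) \<bullet> w"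
proof -
  obtain c where c: "A \<in> components {z \<in> circle. \<gamma> z \<bullet> w = c}"
      and ev: "\<forall>a\<in>A. eventually (\<lambda>z. \<gamma> z \<bullet> w \<le> c) (at a within circle)"
    using assms by (auto simp: local_max_arcs_def)
  have cs: "\<gamma> (cis s) \<bullet> w = c"
    using in_components_subset [OF c] assms(2) by auto
  have "\<forall>\<^sub>F z in nhds (cis s). z \<noteq> cis s \<longrightarrow> z \<in> circle \<longrightarrow> \<gamma> z \<bullet> w \<le> c"
    using ev assms(2) by (auto simp: eventually_at_filter)
  moreover have "filterlim cis (nhds (cis s)) (nhds s)"
    by (rule tendsto_cis) (rule filterlim_ident)
  ultimately have "\<forall>\<^sub>F t in nhds s. cis t \<noteq> cis s \<longrightarrow> cis t \<in> circle \<longrightarrow> \<gamma> (cis t) \<bullet> w \<le> c"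
    by (rule eventually_compose_filterlim)
  then show ?thesis
    by eventually_elim (auto simp: cs)
qed

lemma local_max_arcs_level:
  assumes "A \<in> local_max_arcs w \<gamma>" "cis s \<in> A"
  shows "A \<in> components {z \<in> circle. \<gamma> z \<bullet> w = \<gamma> (cis s) \<bullet> w}"
proof -
  obtain c where c: "A \<in> components {z \<in> circle. \<gamma> z \<bullet> w = c}"
    using assms by (auto simp: local_max_arcs_def)
  then show ?thesis
    using in_components_subset [OF c] assms(2) by auto
qed

text \<open>The parameters that \<open>cis\<close> maps into \<open>A\<close> form a closed subset
  of the interval, since components of a closed level set are closed. The subset is also open: near
  each of its points the height is at most the level by local maximality and at least the level by
  assumption, so the curve stays in the component. As the interval is connected, all of it is mapped
  into \<open>A\<close>. Thus a maximal arc can only be left by going strictly below its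
  level.\<close>

lemma local_max_arcs_absorb:
  assumes \<gamma>: "continuous_on circle \<gamma>" and A: "A \<in> local_max_arcs w \<gamma>"
    and u: "u \<in> {s..t}" "cis u \<in> A"
    and ge: "\<And>r. r \<in> {s..t} \<Longrightarrow> \<gamma> (cis u) \<bullet> w \<le> \<gamma> (cis r) \<bullet> w"
    and r: "r \<in> {s..t}"
  shows "cis r \<in> A"
proof -
  define c where "c = \<gamma> (cis u) \<bullet> w"
  let ?L = "{z \<in> circle. \<gamma> z \<bullet> w = c}"
  have comp: "A \<in> components ?L"
    using local_max_arcs_level [OF A u(2)] by (simp add: c_def)
  define E where "E = {r \<in> {s..t}. cis r \<in> A}"
  have "closed ?L"
    by (intro continuous_closed_preimage_constant continuous_intros \<gamma>) simp
  then have "closed A"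
    using closed_components comp by blast
  then have "closed (cis -` A)"
    by (intro closed_vimage continuous_intros)
  then have "closedin (top_of_set {s..t}) E"
    unfolding E_def closedin_closed by (intro exI [of _ "cis -` A"]) auto
  moreover have "openin (top_of_set {s..t}) E"
    unfolding openin_euclidean_subtopology_iff
  proof (intro conjI ballI)
    show "E \<subseteq> {s..t}"
      by (auto simp: E_def)
    fix a assume a: "a \<in> E"
    then have ca: "\<gamma> (cis a) \<bullet> w = c"
      using in_components_subset [OF comp] by (auto simp: E_def)
    have "\<forall>\<^sub>F r in nhds a. \<gamma> (cis r) \<bullet> w \<le> c"
      using local_max_arcs_eventually_le [OF A, of a] a by (simp add: E_def ca)
    then obtain d where "d > 0" and d: "\<And>r. dist r a < d \<Longrightarrow> \<gamma> (cis r) \<bullet> w \<le> c"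
      by (auto simp: eventually_nhds_metric)
    let ?J = "{s..t} \<inter> ball a d"
    have "connected (cis ` ?J)"
      by (intro connected_continuous_image continuous_intros convex_connected convex_Int) simp_all
    moreover have "cis ` ?J \<subseteq> ?L"
      using d ge by (auto simp: c_def dist_commute intro!: antisym)
    moreover have "cis a \<in> cis ` ?J" "cis a \<in> A"
      using a \<open>d > 0\<close> by (auto simp: E_def)
    ultimately have "cis ` ?J \<subseteq> A"
      using components_maximal [OF comp] by blast
    then show "\<exists>e>0. \<forall>x'\<in>{s..t}. dist x' a < e \<longrightarrow> x' \<in> E"
      using \<open>d > 0\<close> by (intro exI [of _ d]) (auto simp: E_def dist_commute)
  qed
  moreover have "E \<noteq> {}"
    using u by (auto simp: E_def)
  ultimately have "E = {s..t}"
    using connected_clopen [of "{s..t}"] connected_Icc by blast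
  then have "r \<in> E"
    using r by simp
  then show ?thesis
    by (simp add: E_def)
qed

lemma integral_shift_period:
  fixes q :: "real \<Rightarrow> real"
  assumes q: "continuous_on UNIV q" and per: "\<And>t. q (t + p) = q t" and "0 \<le> a" "a \<le> p"
  shows "integral {a..a + p} q = integral {0..p} q"
proof -
  have int: "q integrable_on {c..d}" for c d
    by (intro integrable_continuous_interval continuous_on_subset [OF q]) simp
  have "integral {a..a + p} q = integral {a..p} q + integral {p..a + p} q"
    using assms int by (intro Henstock_Kurzweil_Integration.integral_combine [symmetric]) auto
  also have "integral {p..a + p} q = integral {0..a} q"
    using integral_shift_real_ivl [of p p "a + p" q] by (simp add: per)
  also have "integral {a..p} q + integral {0..a} q = integral {0..p} q"
    using assms int Henstock_Kurzweil_Integration.integral_combine [of 0 a p q] by simp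
  finally show ?thesis .
qed

text \<open>Here \<open>\<sigma>\<close> is the speed. Since it is positive, the height in direction
  \<open>w\<close> is critical exactly where \<open>T \<bullet> w\<close> vanishes.\<close>

locale closed_frame = unit_frame +
  fixes \<gamma> :: closed_curve and \<sigma> :: "real \<Rightarrow> real"
  assumes continuous_curve: "continuous_on circle \<gamma>"
    and has_derivative_curve: "\<And>t. ((\<lambda>t. \<gamma> (cis t)) has_vector_derivative \<sigma> t *\<^sub>R T t) (at t)"
    and speed_pos: "\<And>t. 0 < \<sigma> t"
    and periodic: "\<And>t. T (t + 2 * pi) = T t" "\<And>t. B (t + 2 * pi) = B t"
      "\<And>t. T' (t + 2 * pi) = T' t" "\<And>t. B' (t + 2 * pi) = B' t"
begin

section \<open>Critical points of heights and the excursions between them\<close>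

lemma has_derivative_height:
  "((\<lambda>t. \<gamma> (cis t) \<bullet> w) has_real_derivative \<sigma> t * (T t \<bullet> w)) (at t)"
  using bounded_linear.has_vector_derivative [OF bounded_linear_inner_left has_derivative_curve]
  by (simp add: has_real_derivative_iff_has_vector_derivative)

lemma continuous_height: "continuous_on S (\<lambda>t. \<gamma> (cis t) \<bullet> w)"
  by (intro continuous_at_imp_continuous_on ballI DERIV_isCont [OF has_derivative_height])

lemma critical_if_extremal:
  assumes "0 < d" "\<And>t. \<bar>s - t\<bar> < d \<Longrightarrow> \<gamma> (cis t) \<bullet> w \<le> \<gamma> (cis s) \<bullet> w"
  shows "T s \<bullet> w = 0"
  using DERIV_local_max [OF has_derivative_height assms(1), of s w] assms(2) speed_pos [of s] by simp

lemma critical_if_local_max_arcs: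
  assumes "A \<in> local_max_arcs w \<gamma>" "cis s \<in> A"
  shows "T s \<bullet> w = 0"
proof -
  obtain d where "d > 0" "\<And>t. dist t s < d \<Longrightarrow> \<gamma> (cis t) \<bullet> w \<le> \<gamma> (cis s) \<bullet> w"
    using local_max_arcs_eventually_le [OF assms] by (auto simp: eventually_nhds_metric)
  then show ?thesis
    using critical_if_extremal [of d s w] by (simp add: dist_real_def abs_minus_commute)
qed

text \<open>As the heights at the ends differ, the mean value theorem gives a point with
  \<open>T \<bullet> w\<close> nonzero. The neighbouring zeros of \<open>T \<bullet> w\<close> bound
  an excursion, which stays inside the interval because its ends are critical.\<close>

lemma density_between_critical:
  assumes v: "transversal v" and w: "norm w = 1" "w \<bullet> v = 0"
    and crit: "T a \<bullet> w = 0" "T b \<bullet> w = 0"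
    and "a < b" and neq: "\<gamma> (cis a) \<bullet> w \<noteq> \<gamma> (cis b) \<bullet> w" and "0 < \<delta>"
  shows "\<forall>\<^sub>F k in sequentially. pi - \<delta> \<le> integral {a..b} (total_density k v)"
proof -
  obtain r where r: "a < r" "r < b" "T r \<bullet> w \<noteq> 0"
    using MVT2 [OF \<open>a < b\<close> has_derivative_height, of w] neq by (metis eq_iff_diff_eq_0 mult_eq_0_iff)
  obtain \<alpha> \<beta> where ab: "a \<le> \<alpha>" "\<alpha> < \<beta>" "\<beta> \<le> b" "T \<alpha> \<bullet> w = 0" "T \<beta> \<bullet> w = 0"
      "\<And>t. t \<in> {\<alpha><..<\<beta>} \<Longrightarrow> T t \<bullet> w \<noteq> 0"
  proof (rule zeros_around_nonzero [of a b "\<lambda>t. T t \<bullet> w" r])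
    show "continuous_on {a..b} (\<lambda>t. T t \<bullet> w)"
      by (intro continuous_intros continuous_T)
  qed (use crit r in auto)
  have mono: "integral {\<alpha>..\<beta>} (total_density k v) \<le> integral {a..b} (total_density k v)" for k
    using ab v by (intro integral_subset_le integrable_continuous_interval continuous_total_density)
      (auto simp: total_density_nonneg)
  have "\<forall>\<^sub>F k in sequentially. pi - \<delta> \<le> integral {\<alpha>..\<beta>} (total_density k v)"
    by (rule density_excursion [OF v w ab(2,4,5,6) \<open>0 < \<delta>\<close>])
  then show ?thesis
    by eventually_elim (rule order_trans [OF _ mono])
qed

text \<open>A lowest point \<open>b\<close> between two maxima lies strictly below both, so there is
  an excursion on either side of it, and each contributes pi up to half of \<open>\<delta>\<close>.
  The second alternative of \<open>ne\<close> covers a full turn that returns to the same maximal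
  arc.\<close>

lemma density_between_maxima:
  assumes v: "transversal v" and w: "norm w = 1" "w \<bullet> v = 0"
    and A: "A \<in> local_max_arcs w \<gamma>" "A' \<in> local_max_arcs w \<gamma>" "cis s \<in> A" "cis t \<in> A'"
    and "s < t" and ne: "A \<noteq> A' \<or> (\<exists>r\<in>{s..t}. \<gamma> (cis r) \<bullet> w \<noteq> \<gamma> (cis s) \<bullet> w)" and "0 < \<delta>"
  shows "\<forall>\<^sub>F k in sequentially. 2 * pi - \<delta> \<le> integral {s..t} (total_density k v)"
proof -
  let ?g = "\<lambda>t. \<gamma> (cis t) \<bullet> w"
  obtain b where b: "b \<in> {s..t}" "\<And>r. r \<in> {s..t} \<Longrightarrow> ?g b \<le> ?g r"
    using continuous_attains_inf [OF _ _ continuous_height, of "{s..t}" w] \<open>s < t\<close> by auto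
  have level: "?g z = ?g x" if "C \<in> local_max_arcs w \<gamma>" "cis x \<in> C" "cis z \<in> C" for C x z
    using in_components_subset [OF local_max_arcs_level [OF that(1,2)]] that(3) by auto
  \<comment> \<open>If an end were not above the lowest level, its arc would absorb the whole
    interval. Then both arcs would coincide and the height would be constant, contrary to
    \<open>ne\<close>.\<close>
  have absorb: False if "u \<in> {s, t}" "C \<in> {A, A'}" "cis u \<in> C" "?g u \<le> ?g b" for u C
  proof -
    have C: "C \<in> local_max_arcs w \<gamma>"
      using that A by auto
    have "cis r \<in> C" if "r \<in> {s..t}" for r
    proof (rule local_max_arcs_absorb [OF continuous_curve C _ \<open>cis u \<in> C\<close> _ that])
      show "u \<in> {s..t}"
        using \<open>u \<in> {s, t}\<close> \<open>s < t\<close> by auto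
      show "?g u \<le> ?g x" if "x \<in> {s..t}" for x
        using b(2) [OF that] \<open>?g u \<le> ?g b\<close> by linarith
    qed
    note on_C = this
    have AC: "A = C" "A' = C"
      using local_max_arcs_disjoint [OF A(1) C A(3)] local_max_arcs_disjoint [OF A(2) C A(4)]
        on_C \<open>s < t\<close> by simp_all
    obtain r where r: "r \<in> {s..t}" "?g r \<noteq> ?g s"
      using ne unfolding AC by blast
    then show False
      using level [OF C, of s r] on_C \<open>s < t\<close> by simp
  qed
  have lt: "?g b < ?g s" "?g b < ?g t"
    using absorb [of s A] absorb [of t A'] A(3,4) not_le by blast+
  have "b \<noteq> s" "b \<noteq> t"
    using lt by auto
  then have sbt: "s < b" "b < t"
    using b(1) by simp_all
  \<comment> \<open>A minimum in direction \<open>w\<close> is a maximum in the opposite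
    direction.\<close>
  have "T b \<bullet> - w = 0"
  proof (rule critical_if_extremal)
    show "0 < min (b - s) (t - b)"
      using sbt by simp
    show "\<gamma> (cis x) \<bullet> - w \<le> \<gamma> (cis b) \<bullet> - w" if "\<bar>b - x\<bar> < min (b - s) (t - b)" for x
    proof -
      have "x \<in> {s..t}"
        unfolding atLeastAtMost_iff using that by linarith
      then show ?thesis
        using b(2) by simp
    qed
  qed
  then have Tb: "T b \<bullet> w = 0"
    by simp
  have "\<forall>\<^sub>F k in sequentially. pi - \<delta> / 2 \<le> integral {s..b} (total_density k v)"
    using density_between_critical [OF v w critical_if_local_max_arcs [OF A(1,3)] Tb sbt(1)] lt \<open>0 < \<delta>\<close>
    by auto
  moreover have "\<forall>\<^sub>F k in sequentially. pi - \<delta> / 2 \<le> integral {b..t} (total_density k v)"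
    using density_between_critical [OF v w Tb critical_if_local_max_arcs [OF A(2,4)] sbt(2)] lt \<open>0 < \<delta>\<close>
    by auto
  ultimately show ?thesis
  proof eventually_elim
    case (elim k)
    moreover have "integral {s..b} (total_density k v) + integral {b..t} (total_density k v) = integral {s..t} (total_density k v)"
      using sbt v by (intro Henstock_Kurzweil_Integration.integral_combine integrable_continuous_interval continuous_total_density) auto
    ultimately show ?case
      by linarith
  qed
qed

text \<open>The points of \<open>S\<close> leave \<open>card S - 1\<close> consecutive gaps, and
  each contributes \<open>c\<close>. The induction appends the points in increasing order and splits
  the loss \<open>\<delta>\<close> evenly between the old points and the new gap.\<close>

lemma density_chain:
  assumes v: "transversal v" and "finite S" "S \<noteq> {}"
    and step: "\<And>s t \<delta>. \<lbrakk>s \<in> S; t \<in> S; s < t; 0 < \<delta>\<rbrakk> \<Longrightarrow> \<forall>\<^sub>F k in sequentially. c - \<delta> \<le> integral {s..t} (total_density k v)"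
    and "0 < \<delta>"
  shows "\<forall>\<^sub>F k in sequentially. (real (card S) - 1) * c - \<delta> \<le> integral {Min S..Max S} (total_density k v)"
  using assms(2-)
proof (induction S arbitrary: \<delta> rule: finite_linorder_max_induct)
  case empty
  then show ?case by simp
next
  case (insert b S)
  show ?case
  proof (cases "S = {}")
    case True
    then show ?thesis
      using insert.prems by simp
  next
    case False
    have MS: "Max S \<in> S" "Min S \<in> S"
      using insert.hyps False by simp_all
    then have M: "Max S < b" "Min S < b" "Min S \<le> Max S"
      using insert.hyps by simp_all
    then have Mb: "Min (insert b S) = Min S" "Max (insert b S) = b"
      using insert.hyps False by simp_all
    have "\<forall>\<^sub>F k in sequentially. (real (card S) - 1) * c - \<delta> / 2 \<le> integral {Min S..Max S} (total_density k v)"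
      using insert False by auto
    moreover have "\<forall>\<^sub>F k in sequentially. c - \<delta> / 2 \<le> integral {Max S..b} (total_density k v)"
      using insert.prems(2) [of "Max S" b "\<delta> / 2"] insert.prems(3) M MS by simp
    ultimately show ?thesis
    proof eventually_elim
      case (elim k)
      moreover have "integral {Min S..Max S} (total_density k v) + integral {Max S..b} (total_density k v) = integral {Min S..b} (total_density k v)"
        using M v by (intro Henstock_Kurzweil_Integration.integral_combine integrable_continuous_interval continuous_total_density) auto
      moreover have "real (card (insert b S)) = real (card S) + 1"
        using insert.hyps by (subst card_insert_disjoint) auto
      ultimately show ?case
        unfolding Mb by (simp add: algebra_simps)
    qed
  qed
qed

text \<open>A constant height would make \<open>T\<close> and \<open>T'\<close> orthogonal to
  \<open>w\<close>, and hence \<open>B\<close> parallel to \<open>w\<close>, which is impossible if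
  \<open>B 0 \<bullet> v\<close> is nonzero. This excludes the case in which the whole circle is one
  maximal arc with no excursion.\<close>

lemma height_not_constant:
  assumes "B 0 \<bullet> v \<noteq> 0" "norm w = 1" "w \<bullet> v = 0"
  shows "\<exists>r\<in>{s..s + 2 * pi}. \<gamma> (cis r) \<bullet> w \<noteq> \<gamma> (cis s) \<bullet> w"
proof (rule ccontr)
  assume "\<not> ?thesis"
  then have const: "\<gamma> (cis r) \<bullet> w = \<gamma> (cis s) \<bullet> w" if "r \<in> {s..s + 2 * pi}" for r
    using that by blast
  \<comment> \<open>Shifting by multiples of 2 pi extends constancy from one period to the whole
    line, so every parameter is an extremal point with a full neighbourhood.\<close>
  have all: "\<gamma> (cis r) \<bullet> w = \<gamma> (cis s) \<bullet> w" for r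
  proof -
    define n where "n = \<lfloor>(r - s) / (2 * pi)\<rfloor>"
    have "of_int n \<le> (r - s) / (2 * pi)" "(r - s) / (2 * pi) < of_int n + 1"
      unfolding n_def by linarith+
    then have "r - 2 * pi * of_int n \<in> {s..s + 2 * pi}"
      by (simp add: field_simps)
    moreover have "cis (r - 2 * pi * of_int n) = cis r"
      by (simp add: cis_divide [symmetric] cis_multiple_2pi)
    ultimately show ?thesis
      using const by metis
  qed
  have Tw: "T t \<bullet> w = 0" for t
  proof (rule critical_if_extremal [OF zero_less_one])
    show "\<gamma> (cis r) \<bullet> w \<le> \<gamma> (cis t) \<bullet> w" for r
      using all [of r] all [of t] by linarith
  qed
  have T'w: "T' t \<bullet> w = 0" for t
  proof -
    have "((\<lambda>t. T t \<bullet> w) has_real_derivative T' t \<bullet> w) (at t)"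
      using bounded_linear.has_vector_derivative [OF bounded_linear_inner_left has_derivative_T]
      by (simp add: has_real_derivative_iff_has_vector_derivative)
    then show ?thesis
      unfolding Tw using DERIV_const DERIV_unique by blast
  qed
  \<comment> \<open>The double product of \<open>w\<close> with \<open>T 0\<close> and
    \<open>T' 0\<close> has coefficients \<open>w \<bullet> T' 0\<close> and
    \<open>w \<bullet> T 0\<close>, both zero.\<close>
  have "cross3 w (B 0) = 0"
    using Lagrange [of w "T 0" "T' 0"] Tw [of 0] T'w [of 0] T'_nonzero [of 0]
    by (simp add: cross_T_T' cross_mult_right inner_commute)
  then have "(w \<bullet> B 0) *\<^sub>R w = B 0"
    using Lagrange [of w w "B 0"] assms(2) by (simp add: dot_square_norm)
  then have "B 0 \<bullet> v = (w \<bullet> B 0) * (w \<bullet> v)"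
    by (metis inner_scaleR_left)
  then show False
    using assms by simp
qed

text \<open>One parameter is chosen in each arc, and the first one is repeated a full turn later.
  This gives as many gaps as arcs, each contributing 2 pi. A finite subfamily is used because it is
  not yet known that there are only finitely many arcs.\<close>

proposition card_local_max_arcs_le:
  assumes v: "transversal v" "B 0 \<bullet> v \<noteq> 0" and w: "norm w = 1" "w \<bullet> v = 0"
    and \<A>: "finite \<A>" "\<A> \<subseteq> local_max_arcs w \<gamma>" and "0 < \<delta>"
  shows "\<forall>\<^sub>F k in sequentially. 2 * pi * real (card \<A>) - \<delta> \<le> integral {0..2 * pi} (total_density k v)"
proof (cases "\<A> = {}")
  case True
  have "0 \<le> integral {0..2 * pi} (total_density k v)" for k
    using v by (intro integral_nonneg integrable_continuous_interval continuous_total_density) (simp_all add: total_density_nonneg)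
  then show ?thesis
    using True \<open>0 < \<delta>\<close> by (auto intro!: always_eventually intro: order_trans [of _ 0])
next
  case False
  have "\<exists>s. 0 \<le> s \<and> s < 2 * pi \<and> cis s \<in> A" if A: "A \<in> \<A>" for A
  proof -
    obtain c where c: "A \<in> components {z \<in> circle. \<gamma> z \<bullet> w = c}"
      using A \<A> by (auto simp: local_max_arcs_def)
    then obtain z where z: "z \<in> A" "z \<in> circle"
      using in_components_nonempty in_components_subset by fastforce
    then have "cis (Arg2pi z) = z"
      using Arg2pi_eq [of z] by (simp add: cis_conv_exp)
    then show ?thesis
      using z Arg2pi [of z] by metis
  qed
  then obtain a where a: "0 \<le> a A" "a A < 2 * pi" "cis (a A) \<in> A" if "A \<in> \<A>" for A
    by metis
  have inj: "inj_on a \<A>"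
  proof (rule inj_onI)
    fix A A' assume "A \<in> \<A>" "A' \<in> \<A>" "a A = a A'"
    then show "A = A'"
      using local_max_arcs_disjoint [of A w \<gamma> A' "cis (a A)"] a(3) [of A] a(3) [of A'] \<A>(2)
      by (simp add: subset_iff)
  qed
  define m where "m = Min (a ` \<A>)"
  \<comment> \<open>The extra point closes the loop, so \<open>card S - 1\<close> is the number of
    arcs.\<close>
  define S where "S = insert (m + 2 * pi) (a ` \<A>)"
  have m: "m \<in> a ` \<A>" "\<And>s. s \<in> a ` \<A> \<Longrightarrow> m \<le> s"
    using \<A>(1) False by (simp_all add: m_def)
  have less: "s < m + 2 * pi" if "s \<in> a ` \<A>" for s
  proof -
    have "s < 2 * pi" "0 \<le> m"
      using that m(1) a(1,2) by blast+
    then show ?thesis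
      by linarith
  qed
  have "m + 2 * pi \<notin> a ` \<A>"
    using less by blast
  then have card: "card S = card \<A> + 1"
    using \<A>(1) inj by (simp add: S_def card_image)
  have Min: "Min S = m"
    using \<A>(1) m by (intro Min_eqI) (auto simp: S_def intro: less_imp_le)
  have Max: "Max S = m + 2 * pi"
    using \<A>(1) less by (intro Max_eqI) (auto simp: S_def intro: less_imp_le)
  have "\<forall>\<^sub>F k in sequentially. (real (card S) - 1) * (2 * pi) - \<delta> \<le> integral {Min S..Max S} (total_density k v)"
  proof (rule density_chain [OF v(1) _ _ _ \<open>0 < \<delta>\<close>])
    fix s t and \<delta> :: real assume st: "s \<in> S" "t \<in> S" "s < t" "0 < \<delta>"
    have "s \<in> a ` \<A>"
    proof (rule ccontr)
      assume "s \<notin> a ` \<A>"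
      then have "s = m + 2 * pi" "t \<in> a ` \<A>"
        using st by (auto simp: S_def)
      then show False
        using less [of t] st(3) by simp
    qed
    then obtain A where A: "A \<in> \<A>" "s = a A"
      by blast
    obtain A0 where A0: "A0 \<in> \<A>" "m = a A0"
      using m by blast
    show "\<forall>\<^sub>F k in sequentially. 2 * pi - \<delta> \<le> integral {s..t} (total_density k v)"
    proof (cases "t = m + 2 * pi")
      case True
      have "cis t = cis m"
        by (simp add: True cis_mult [symmetric])
      \<comment> \<open>If the last gap starts at the first arc, then \<open>s = m\<close> and the
        gap is a full turn, on which the height is not constant.\<close>
      moreover have "A \<noteq> A0 \<or> (\<exists>r\<in>{s..t}. \<gamma> (cis r) \<bullet> w \<noteq> \<gamma> (cis s) \<bullet> w)"
        using height_not_constant [OF v(2) w, of m] A A0 True by auto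
      ultimately show ?thesis
        using \<A> A A0 a(3) st by (intro density_between_maxima [OF v(1) w, of A A0]) auto
    next
      case False
      then obtain A' where A': "A' \<in> \<A>" "t = a A'"
        using st by (auto simp: S_def)
      then show ?thesis
        using \<A> A a(3) st by (intro density_between_maxima [OF v(1) w, of A A']) auto
    qed
  qed (use \<A> in \<open>auto simp: S_def\<close>)
  \<comment> \<open>The chain covers exactly one period, which can be moved back to start at
    0.\<close>
  moreover have "integral {m..m + 2 * pi} (total_density k v) = integral {0..2 * pi} (total_density k v)" for k
  proof (rule integral_shift_period)
    show "continuous_on UNIV (total_density k v)"
      by (rule continuous_total_density [OF v(1)])
    show "total_density k v (t + 2 * pi) = total_density k v t" for t
      by (simp add: total_density_def turning_density_def swing_density_def periodic)
    show "0 \<le> m" "m \<le> 2 * pi"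
      using m(1) a by (auto intro: less_imp_le)
  qed
  ultimately show ?thesis
    by (simp add: card Min Max mult.commute)
qed

end

subsection \<open>Averages over the unit ball\<close>

text \<open>The measure is determined by its values on boxes. The preimage of a box is its image
  under the inverse, again orthogonal, and so has the same volume.\<close>

lemma lborel_distr_orthogonal:
  fixes R :: "real^3 \<Rightarrow> real^3"
  assumes "orthogonal_transformation R"
  shows "distr lborel borel R = lborel"
proof (rule lborel_eqI [symmetric])
  fix l u :: "real^3" assume "\<And>b. b \<in> Basis \<Longrightarrow> l \<bullet> b \<le> u \<bullet> b"
  have R [measurable]: "R \<in> borel \<rightarrow>\<^sub>M borel"
    by (intro borel_measurable_continuous_onI linear_continuous_on linear_conv_bounded_linear [THEN iffD1]
        orthogonal_transformation_linear assms)
  have bij: "bij R"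
    using assms by (rule orthogonal_transformation_bij)
  have inv: "orthogonal_transformation (inv R)"
    using assms by (rule orthogonal_transformation_inv)
  have eq: "R -` box l u = inv R ` box l u"
    using bij by (simp add: bij_vimage_eq_inv_image)
  have meas: "inv R ` box l u \<in> lmeasurable"
    using inv lmeasurable_box by (rule measurable_orthogonal_image)
  have "emeasure (distr lborel borel R) (box l u) = emeasure lborel (R -` box l u)"
    by (simp add: emeasure_distr)
  also have "\<dots> = emeasure lebesgue (R -` box l u)"
    using measurable_sets [OF R, of "box l u"] by (simp add: emeasure_completion)
  also have "\<dots> = ennreal (measure lebesgue (box l u))"
    unfolding eq using meas measure_orthogonal_image [OF inv lmeasurable_box] by (simp add: emeasure_eq_measure2)
  also have "\<dots> = emeasure lborel (box l u)"
    using emeasure_eq_measure2 [OF lmeasurable_box, of l u] by (simp add: emeasure_completion)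
  also have "\<dots> = (\<Prod>b\<in>Basis. (u - l) \<bullet> b)"
    using \<open>\<And>b. b \<in> Basis \<Longrightarrow> l \<bullet> b \<le> u \<bullet> b\<close> by (rule emeasure_lborel_box)
  finally show "emeasure (distr lborel borel R) (box l u) = (\<Prod>b\<in>Basis. (u - l) \<bullet> b)" .
qed simp

lemma orthonormal_pair_transformation:
  fixes a b :: "real^3"
  assumes ab: "norm a = 1" "norm b = 1" "a \<bullet> b = 0"
  obtains R :: "real^3 \<Rightarrow> real^3" where "orthogonal_transformation R" "\<And>x. R x \<bullet> a = x$1" "\<And>x. R x \<bullet> b = x$2"
proof -
  let ?c = "cross3 a b"
  \<comment> \<open>The columns of this orthogonal matrix are \<open>a\<close>, \<open>b\<close> and
    their cross product.\<close>
  define R where "R x = x$1 *\<^sub>R a + x$2 *\<^sub>R b + x$3 *\<^sub>R ?c" for x :: "real^3"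
  have ip: "a \<bullet> a = 1" "b \<bullet> b = 1" "a \<bullet> b = 0" "b \<bullet> a = 0" "?c \<bullet> a = 0" "?c \<bullet> b = 0" "a \<bullet> ?c = 0" "b \<bullet> ?c = 0"
    using ab by (simp_all add: dot_square_norm dot_cross_self inner_commute)
  have "?c \<bullet> ?c = 1"
    using norm_cross_dot [of a b] ab by (simp add: dot_square_norm)
  note ip = ip this
  have "R x \<bullet> a = x$1" "R x \<bullet> b = x$2" for x
    by (simp_all add: R_def inner_add_left ip)
  moreover have "linear R"
    by (intro linearI) (simp_all add: R_def algebra_simps)
  moreover have "R x \<bullet> R y = x \<bullet> y" for x y
  proof -
    have "R x \<bullet> R y = x$1 * y$1 + x$2 * y$2 + x$3 * y$3"
      by (simp add: R_def inner_add_left inner_add_right ip)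
    then show ?thesis
      by (simp add: inner_vec_def sum_3)
  qed
  ultimately have "orthogonal_transformation R" "\<And>x. R x \<bullet> a = x$1" "\<And>x. R x \<bullet> b = x$2"
    by (simp_all add: orthogonal_transformation_def)
  then show thesis
    by (rule that)
qed

text \<open>By rotation invariance all orthonormal pairs give the same integral; the right side,
  taken with the standard axes, serves as its common value.\<close>

lemma nn_integral_unit_ball_orthonormal:
  fixes a b :: "real^3" and \<Psi> :: "real \<times> real \<times> real \<Rightarrow> ennreal"
  assumes "norm a = 1" "norm b = 1" "a \<bullet> b = 0" and [measurable]: "\<Psi> \<in> borel_measurable borel"
  shows "(\<integral>\<^sup>+v. \<Psi> (a \<bullet> v, b \<bullet> v, norm v) * indicator (ball 0 1) v \<partial>lborel)
    = (\<integral>\<^sup>+v. \<Psi> ((v::real^3)$1, v$2, norm v) * indicator (ball 0 1) v \<partial>lborel)"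
proof -
  obtain R :: "real^3 \<Rightarrow> real^3" where R: "orthogonal_transformation R" "\<And>x. R x \<bullet> a = x$1" "\<And>x. R x \<bullet> b = x$2"
    by (rule orthonormal_pair_transformation [OF assms(1-3)]) (rule that)
  have [measurable]: "R \<in> borel \<rightarrow>\<^sub>M borel"
    by (intro borel_measurable_continuous_onI linear_continuous_on linear_conv_bounded_linear [THEN iffD1]
        orthogonal_transformation_linear R)
  have "(\<lambda>v. (a \<bullet> v, b \<bullet> v, norm v)) \<in> borel_measurable borel"
    by (intro borel_measurable_continuous_onI continuous_intros)
  from measurable_compose [OF this assms(4)]
  have [measurable]: "(\<lambda>v. \<Psi> (a \<bullet> v, b \<bullet> v, norm v)) \<in> borel_measurable borel" .
  have "(\<integral>\<^sup>+v. \<Psi> (a \<bullet> v, b \<bullet> v, norm v) * indicator (ball 0 1) v \<partial>lborel)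
      = (\<integral>\<^sup>+v. \<Psi> (a \<bullet> v, b \<bullet> v, norm v) * indicator (ball 0 1) v \<partial>distr lborel borel R)"
    by (simp only: lborel_distr_orthogonal [OF R(1)])
  also have "\<dots> = (\<integral>\<^sup>+v. \<Psi> (a \<bullet> R v, b \<bullet> R v, norm (R v)) * indicator (ball 0 1) (R v) \<partial>lborel)"
  proof (rule nn_integral_distr)
    have "(\<lambda>v. \<Psi> (a \<bullet> v, b \<bullet> v, norm v) * indicator (ball 0 1) v) \<in> borel_measurable borel"
      by (rule borel_measurable_times_ennreal) (measurable, simp)
    then show "(\<lambda>v. \<Psi> (a \<bullet> v, b \<bullet> v, norm v) * indicator (ball 0 1) v) \<in> borel_measurable (distr lborel borel R)"
      by simp
  qed simp
  also have "\<dots> = (\<integral>\<^sup>+v. \<Psi> ((v::real^3)$1, v$2, norm v) * indicator (ball 0 1) v \<partial>lborel)"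
    using R by (simp add: inner_commute [of a] inner_commute [of b] orthogonal_transformation_norm indicator_def)
  finally show ?thesis .
qed

lemma measurable_indicator_fst:
  fixes S :: "'a::euclidean_space set"
  assumes "S \<in> sets borel"
  shows "(\<lambda>x :: 'a \<times> 'b::euclidean_space. indicator S (fst x) :: ennreal) \<in> borel_measurable borel"
  by (rule measurable_compose [OF borel_measurable_continuous_onI [OF continuous_on_fst [OF continuous_on_id]]
        borel_measurable_indicator [OF assms]])

lemma measurable_indicator_snd:
  fixes S :: "'b::euclidean_space set"
  assumes "S \<in> sets borel"
  shows "(\<lambda>x :: 'a::euclidean_space \<times> 'b. indicator S (snd x) :: ennreal) \<in> borel_measurable borel"
  by (rule measurable_compose [OF borel_measurable_continuous_onI [OF continuous_on_snd [OF continuous_on_id]]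
        borel_measurable_indicator [OF assms]])

text \<open>The integral is the same for every pair \<open>a t\<close>, \<open>b t\<close>.
  Averaging it over \<open>t\<close> and exchanging the integrals by Fubini leaves, for each fixed
  \<open>v\<close>, a one-dimensional integral over a full turn, which \<open>circle\<close>
  bounds.\<close>

lemma nn_integral_unit_ball_le:
  fixes p q :: "real^3" and a b :: "real \<Rightarrow> real^3" and \<Psi> :: "real \<times> real \<times> real \<Rightarrow> ennreal"
  assumes pq: "norm p = 1" "norm q = 1" "p \<bullet> q = 0"
    and ab: "\<And>t. norm (a t) = 1" "\<And>t. norm (b t) = 1" "\<And>t. a t \<bullet> b t = 0"
    and cont: "continuous_on UNIV a" "continuous_on UNIV b"
    and \<Psi> [measurable]: "\<Psi> \<in> borel_measurable borel"
    and circle: "\<And>v. (\<integral>\<^sup>+t. \<Psi> (a t \<bullet> v, b t \<bullet> v, norm v) * indicator {0..2 * pi} t \<partial>lborel) \<le> ennreal (2 * pi)"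
  shows "(\<integral>\<^sup>+v. \<Psi> (p \<bullet> v, q \<bullet> v, norm v) * indicator (ball 0 1) v \<partial>lborel) \<le> emeasure lborel (ball (0::real^3) 1)"
    (is "?I \<le> ?V")
proof -
  have I: "?I = (\<integral>\<^sup>+v. \<Psi> (a t \<bullet> v, b t \<bullet> v, norm v) * indicator (ball 0 1) v \<partial>lborel)" for t
    using pq ab \<Psi> by (simp add: nn_integral_unit_ball_orthonormal)
  have "(\<lambda>x. (a (snd x) \<bullet> fst x, b (snd x) \<bullet> fst x, norm (fst x))) \<in> borel_measurable borel"
    by (intro borel_measurable_continuous_onI continuous_intros continuous_on_compose2 [OF cont(1)]
        continuous_on_compose2 [OF cont(2)]) auto
  from measurable_compose [OF this \<Psi>]
  have "(\<lambda>x. \<Psi> (a (snd x) \<bullet> fst x, b (snd x) \<bullet> fst x, norm (fst x))) \<in> borel_measurable borel" .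
  then have "(\<lambda>x. \<Psi> (a (snd x) \<bullet> fst x, b (snd x) \<bullet> fst x, norm (fst x)) * indicator (ball 0 1) (fst x)
      * indicator {0..2 * pi} (snd x)) \<in> borel_measurable borel"
    by (intro borel_measurable_times_ennreal measurable_indicator_fst measurable_indicator_snd) simp_all
  then have meas: "(\<lambda>(v, t). \<Psi> (a t \<bullet> v, b t \<bullet> v, norm v) * indicator (ball 0 1) v * indicator {0..2 * pi} t)
      \<in> borel_measurable (lborel \<Otimes>\<^sub>M lborel)"
    by (simp add: lborel_prod case_prod_unfold)
  have "ennreal (2 * pi) * ?I = (\<integral>\<^sup>+t. ?I * indicator {0..2 * pi} t \<partial>lborel)"
    by (subst nn_integral_cmult_indicator) (simp_all add: mult.commute)
  also have "\<dots> = (\<integral>\<^sup>+t. (\<integral>\<^sup>+v. \<Psi> (a t \<bullet> v, b t \<bullet> v, norm v) * indicator (ball 0 1) v * indicator {0..2 * pi} t \<partial>lborel) \<partial>lborel)"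
  proof (rule nn_integral_cong)
    fix t :: real
    show "?I * indicator {0..2 * pi} t
        = (\<integral>\<^sup>+v. \<Psi> (a t \<bullet> v, b t \<bullet> v, norm v) * indicator (ball 0 1) v * indicator {0..2 * pi} t \<partial>lborel)"
      unfolding I [of t] by (cases "t \<in> {0..2 * pi}") simp_all
  qed
  also have "\<dots> = (\<integral>\<^sup>+v. (\<integral>\<^sup>+t. \<Psi> (a t \<bullet> v, b t \<bullet> v, norm v) * indicator (ball 0 1) v * indicator {0..2 * pi} t \<partial>lborel) \<partial>lborel)"
    by (rule lborel_pair.Fubini' [OF meas])
  also have "\<dots> = (\<integral>\<^sup>+v. (\<integral>\<^sup>+t. \<Psi> (a t \<bullet> v, b t \<bullet> v, norm v) * indicator {0..2 * pi} t \<partial>lborel) * indicator (ball 0 1) v \<partial>lborel)"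
    by (intro nn_integral_cong) (auto simp: indicator_def)
  also have "\<dots> \<le> (\<integral>\<^sup>+v. ennreal (2 * pi) * indicator (ball 0 1) (v::real^3) \<partial>lborel)"
    by (intro nn_integral_mono mult_right_mono circle) auto
  also have "\<dots> = ennreal (2 * pi) * ?V"
    by (subst nn_integral_cmult_indicator) simp_all
  finally show ?thesis
    by (subst (asm) ennreal_mult_le_mult_iff) auto
qed

section \<open>Integrals over one turn of a great circle\<close>

lemma integral_phase_shift:
  fixes q :: "real \<Rightarrow> real"
  assumes q: "continuous_on UNIV q" and per: "\<And>t. q (t + p) = q t" and \<phi>: "0 \<le> \<phi>" "\<phi> \<le> p"
  shows "integral {0..p} (\<lambda>t. q (t - \<phi>)) = integral {0..p} q"
proof -
  have "integral {0..p} (\<lambda>t. q (t - \<phi>)) = integral {\<phi>..\<phi> + p} (\<lambda>t. q (t - \<phi>))"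
  proof (rule integral_shift_period [symmetric, OF _ _ \<phi>])
    show "continuous_on UNIV (\<lambda>t. q (t - \<phi>))"
      by (rule continuous_on_compose2 [OF q]) (auto intro: continuous_intros)
    show "q (t + p - \<phi>) = q (t - \<phi>)" for t
      using per [of "t - \<phi>"] by (simp add: algebra_simps)
  qed
  also have "\<dots> = integral {0..p} q"
    using integral_shift_real_ivl [of \<phi> \<phi> "\<phi> + p" "\<lambda>t. q (t - \<phi>)"] by simp
  finally show ?thesis .
qed

lemma integral_two_halves:
  fixes q :: "real \<Rightarrow> real"
  assumes q: "continuous_on UNIV q" and per: "\<And>t. q (t + p) = q t" and I: "(q has_integral I) {0..p}" and "0 \<le> p"
  shows "integral {0..2 * p} q = 2 * I"
proof -
  have "integral {0..2 * p} q = integral {0..p} q + integral {p..2 * p} q"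
    using \<open>0 \<le> p\<close> by (intro Henstock_Kurzweil_Integration.integral_combine [symmetric] integrable_continuous_interval
        continuous_on_subset [OF q]) auto
  also have "integral {p..2 * p} q = integral {0..p} q"
    using integral_shift_real_ivl [of p p "2 * p" q] by (simp add: per)
  finally show ?thesis
    using I by (simp add: integral_unique)
qed

text \<open>The denominator equals the squared distance from the origin of the point with
  coordinates \<open>\<bar>c\<bar> * sin s\<close> and \<open>- \<rho> * cos s\<close>, which runs
  along an ellipse. The integrand is the derivative of its angle, so half a turn gives pi by the
  half plane formula, and the other half gives the same by periodicity.\<close>

lemma ellipse_angle_integral:
  fixes c R \<rho> :: real
  assumes "c \<noteq> 0" "0 < \<rho>" and \<rho>: "\<rho>\<^sup>2 = R\<^sup>2 + c\<^sup>2"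
  shows "continuous_on UNIV (\<lambda>s. \<bar>c\<bar> * \<rho> / (\<rho>\<^sup>2 - (R * sin s)\<^sup>2))"
    and "integral {0..2 * pi} (\<lambda>s. \<bar>c\<bar> * \<rho> / (\<rho>\<^sup>2 - (R * sin s)\<^sup>2)) = 2 * pi"
proof -
  let ?q = "\<lambda>s. \<bar>c\<bar> * \<rho> / (\<rho>\<^sup>2 - (R * sin s)\<^sup>2)"
  have den: "\<rho>\<^sup>2 - (R * sin s)\<^sup>2 = (\<bar>c\<bar> * sin s)\<^sup>2 + (- \<rho> * cos s)\<^sup>2" for s
    by (simp add: power_mult_distrib \<rho> sin_squared_eq algebra_simps)
  have pos: "0 < \<rho>\<^sup>2 - (R * sin s)\<^sup>2" for s
  proof -
    have "\<bar>c\<bar> * sin s \<noteq> 0 \<or> - \<rho> * cos s \<noteq> 0"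
      using assms sin_cos_squared_add [of s] by (cases "sin s = 0") auto
    then show ?thesis
      unfolding den by (simp add: sum_power2_gt_zero_iff)
  qed
  show cont: "continuous_on UNIV ?q"
    using pos by (intro continuous_intros) (simp add: less_imp_neq [symmetric])
  have "((\<lambda>s. ((\<bar>c\<bar> * sin s) * (\<rho> * sin s) - (- \<rho> * cos s) * (\<bar>c\<bar> * cos s)) / ((\<bar>c\<bar> * sin s)\<^sup>2 + (- \<rho> * cos s)\<^sup>2)) has_integral
      Im (Ln (Complex (\<bar>c\<bar> * sin pi) (- \<rho> * cos pi))) - Im (Ln (Complex (\<bar>c\<bar> * sin 0) (- \<rho> * cos 0)))) {0..pi}"
  proof (rule half_plane_angle_integral)
    fix t assume "t \<in> {0..pi}"
    then show "0 \<le> \<bar>c\<bar> * sin t"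
      by (simp add: sin_ge_zero)
    show "Complex (\<bar>c\<bar> * sin t) (- \<rho> * cos t) \<noteq> 0"
      using pos [of t] unfolding den by (auto simp: complex_eq_iff)
  qed (auto intro!: derivative_eq_intros)
  moreover have "Im (Ln (Complex 0 \<rho>)) = pi / 2" "Im (Ln (Complex 0 (- \<rho>))) = - (pi / 2)"
    using \<open>0 < \<rho>\<close> by (simp_all add: Im_Ln_Complex_half_plane complex_eq_iff)
  moreover have "(\<bar>c\<bar> * sin s) * (\<rho> * sin s) - (- \<rho> * cos s) * (\<bar>c\<bar> * cos s) = \<bar>c\<bar> * \<rho>" for s
    using sin_cos_squared_add [of s] by algebra
  ultimately have half: "(?q has_integral pi) {0..pi}"
    unfolding den by simp
  show "integral {0..2 * pi} ?q = 2 * pi"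
    using integral_two_halves [OF cont _ half] by simp
qed

text \<open>This is the total variation of \<open>arctan (k * (R * cos s))\<close>. On each half
  turn the function is monotone and changes by \<open>2 * arctan (k * R)\<close>, which is less than
  pi whatever \<open>k\<close> and \<open>R\<close> are.\<close>

lemma arctan_wave_integral_le:
  fixes k R :: real
  assumes "0 \<le> k" "0 \<le> R"
  shows "continuous_on UNIV (\<lambda>s. k * \<bar>- (R * sin s)\<bar> / (1 + (k * (R * cos s))\<^sup>2))"
    and "integral {0..2 * pi} (\<lambda>s. k * \<bar>- (R * sin s)\<bar> / (1 + (k * (R * cos s))\<^sup>2)) \<le> 2 * pi"
proof -
  let ?q = "\<lambda>s. k * \<bar>- (R * sin s)\<bar> / (1 + (k * (R * cos s))\<^sup>2)"
  have pos: "1 + (k * (R * cos s))\<^sup>2 \<noteq> 0" for s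
    by (smt (verit) zero_le_power2)
  show cont: "continuous_on UNIV ?q"
    using pos by (intro continuous_intros) simp
  have "(?q has_integral - arctan (k * (R * cos pi)) - (- arctan (k * (R * cos 0)))) {0..pi}"
  proof (rule fundamental_theorem_of_calculus)
    fix s assume s: "s \<in> {0..pi}"
    have "((\<lambda>s. - arctan (k * (R * cos s))) has_real_derivative ?q s) (at s)"
      using s assms by (auto intro!: derivative_eq_intros simp: divide_inverse sin_ge_zero abs_mult)
    then show "((\<lambda>s. - arctan (k * (R * cos s))) has_vector_derivative ?q s) (at s within {0..pi})"
      by (simp add: has_field_derivative_at_within has_real_derivative_iff_has_vector_derivative [symmetric])
  qed simp
  from integral_two_halves [OF cont _ this]
  have "integral {0..2 * pi} ?q = 4 * arctan (k * R)"
    by (simp add: arctan_minus)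
  then show "integral {0..2 * pi} ?q \<le> 2 * pi"
    using arctan_ubound [of "k * R"] by simp
qed

lemma polar_coordinates_real:
  fixes x y :: real
  obtains \<phi> where "0 \<le> \<phi>" "\<phi> \<le> 2 * pi" "x = sqrt (x\<^sup>2 + y\<^sup>2) * cos \<phi>" "y = sqrt (x\<^sup>2 + y\<^sup>2) * sin \<phi>"
proof (cases "x = 0 \<and> y = 0")
  case True
  then show ?thesis
    using that [of 0] by simp
next
  case False
  define R where "R = sqrt (x\<^sup>2 + y\<^sup>2)"
  have R: "R > 0" "x\<^sup>2 + y\<^sup>2 = R\<^sup>2"
    using False sum_power2_gt_zero_iff [of x y] unfolding R_def by (simp only: real_sqrt_gt_0_iff) (blast, simp)
  then have "(x / R)\<^sup>2 + (y / R)\<^sup>2 = 1"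
    by (simp add: power_divide add_divide_distrib [symmetric])
  then obtain \<phi> where "0 \<le> \<phi>" "\<phi> < 2 * pi" "x / R = cos \<phi>" "y / R = sin \<phi>"
    by (rule sincos_total_2pi)
  then show ?thesis
    using R by (intro that [of \<phi>, folded R_def]) (auto simp: field_simps)
qed

text \<open>The model curve has its tangent run once along a great circle with constant binormal.
  Projected along \<open>v\<close>, the tangent runs along an ellipse and turns by 2 pi in all,
  unless \<open>v\<close> lies in the plane of the circle.\<close>

lemma turning_average_le:
  fixes p q :: "real^3"
  assumes "norm p = 1" "norm q = 1" "p \<bullet> q = 0"
  shows "(\<integral>\<^sup>+v. ennreal (\<bar>q \<bullet> v\<bar> * norm v / ((norm v)\<^sup>2 - (p \<bullet> v)\<^sup>2)) * indicator (ball 0 1) v \<partial>lborel)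
    \<le> emeasure lborel (ball (0::real^3) 1)"
proof -
  define \<Psi> :: "real \<times> real \<times> real \<Rightarrow> ennreal"
    where "\<Psi> = (\<lambda>z. ennreal (\<bar>fst (snd z)\<bar> * snd (snd z) / ((snd (snd z))\<^sup>2 - (fst z)\<^sup>2)))"
  have "(\<integral>\<^sup>+v. \<Psi> (p \<bullet> v, q \<bullet> v, norm v) * indicator (ball 0 1) v \<partial>lborel) \<le> emeasure lborel (ball (0::real^3) 1)"
  proof (rule nn_integral_unit_ball_le [where a = "\<lambda>t. cos t *\<^sub>R axis 1 1 + sin t *\<^sub>R axis 2 1" and b = "\<lambda>t. axis 3 1"])
    show "\<Psi> \<in> borel_measurable borel"
      unfolding \<Psi>_def
      by (intro measurable_compose [OF _ measurable_ennreal] borel_measurable_divide borel_measurable_continuous_onI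
          continuous_intros)
    fix v :: "real^3"
    define R where "R = sqrt ((v$1)\<^sup>2 + (v$2)\<^sup>2)"
    let ?h = "\<lambda>t. \<bar>v$3\<bar> * norm v / ((norm v)\<^sup>2 - (v$1 * cos t + v$2 * sin t)\<^sup>2)"
    have \<rho>: "(norm v)\<^sup>2 = R\<^sup>2 + (v$3)\<^sup>2"
      unfolding power2_norm_eq_inner by (simp add: R_def inner_vec_def sum_3 power2_eq_square [symmetric])
    have "(\<integral>\<^sup>+t. ennreal (?h t) * indicator {0..2 * pi} t \<partial>lborel) \<le> ennreal (2 * pi)"
    proof (cases "v$3 = 0")
      \<comment> \<open>The numerator vanishes, and with it the quotient, even where the denominator
        is zero.\<close>
      case True
      then show ?thesis
        by simp
    next
      case False
      then have v: "norm v > 0"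
        by auto
      \<comment> \<open>The coordinates are exchanged and one sign is changed so that the tangent
        component becomes a sine wave, as in the ellipse formula.\<close>
      obtain \<phi> where \<phi>: "0 \<le> \<phi>" "\<phi> \<le> 2 * pi" "v$2 = R * cos \<phi>" "- v$1 = R * sin \<phi>"
        using polar_coordinates_real [of "v$2" "- v$1"] by (auto simp: R_def add.commute)
      have wave: "v$1 * cos t + v$2 * sin t = R * sin (t - \<phi>)" for t
      proof -
        have "v$1 = - (R * sin \<phi>)"
          using \<phi>(4) by simp
        then show ?thesis
          using \<phi>(3) by (simp add: sin_diff algebra_simps)
      qed
      then have h: "?h = (\<lambda>t. \<bar>v$3\<bar> * norm v / ((norm v)\<^sup>2 - (R * sin (t - \<phi>))\<^sup>2))"
        by simp
      note cont = ellipse_angle_integral(1) [OF False v \<rho>]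
      have "integral {0..2 * pi} ?h = 2 * pi"
        using integral_phase_shift [OF cont _ \<phi>(1,2)] ellipse_angle_integral(2) [OF False v \<rho>]
        unfolding h by simp
      moreover have "continuous_on {0..2 * pi} ?h"
        unfolding h by (rule continuous_on_compose2 [OF cont]) (auto intro: continuous_intros)
      ultimately have "(?h has_integral 2 * pi) {0..2 * pi}"
        using integrable_integral [OF integrable_continuous_interval, of 0 "2 * pi" ?h] by simp
      moreover have "0 \<le> ?h t" for t
      proof -
        have "(R * sin (t - \<phi>))\<^sup>2 \<le> R\<^sup>2 * 1"
          unfolding power_mult_distrib by (intro mult_left_mono) (simp_all add: abs_square_le_1)
        then have "0 \<le> R\<^sup>2 + (v$3)\<^sup>2 - (R * sin (t - \<phi>))\<^sup>2"
          using zero_le_power2 [of "v$3"] by linarith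
        then show ?thesis
          unfolding wave \<rho> by (rule divide_nonneg_nonneg [rotated]) simp
      qed
      ultimately show ?thesis
        by (simp add: nn_integral_has_integral_lebesgue')
    qed
    then show "(\<integral>\<^sup>+t. \<Psi> ((cos t *\<^sub>R axis 1 1 + sin t *\<^sub>R axis 2 1) \<bullet> v, axis 3 1 \<bullet> v, norm v) * indicator {0..2 * pi} t \<partial>lborel) \<le> ennreal (2 * pi)"
      by (simp add: \<Psi>_def inner_add_left inner_diff_left inner_axis' mult.commute)
  qed (use assms in \<open>auto intro!: continuous_intros simp: norm_eq_1 inner_add_left inner_add_right inner_diff_left inner_diff_right inner_axis_axis power2_eq_square [symmetric]\<close>)
  then show ?thesis
    by (simp add: \<Psi>_def)
qed

text \<open>Here the binormal runs along the great circle and \<open>q\<close> stands for its unit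
  derivative. For fixed \<open>v\<close> the inner product with the binormal is a cosine wave, whose
  arctan has total variation at most 2 pi, uniformly in \<open>k\<close>.\<close>

lemma swing_average_le:
  fixes p q :: "real^3"
  assumes "norm p = 1" "norm q = 1" "p \<bullet> q = 0" "0 \<le> k"
  shows "(\<integral>\<^sup>+v. ennreal (k * \<bar>q \<bullet> v\<bar> / (1 + (k * (p \<bullet> v))\<^sup>2)) * indicator (ball 0 1) v \<partial>lborel)
    \<le> emeasure lborel (ball (0::real^3) 1)"
proof -
  define \<Psi> :: "real \<times> real \<times> real \<Rightarrow> ennreal"
    where "\<Psi> = (\<lambda>z. ennreal (k * \<bar>fst (snd z)\<bar> / (1 + (k * fst z)\<^sup>2)))"
  have "(\<integral>\<^sup>+v. \<Psi> (p \<bullet> v, q \<bullet> v, norm v) * indicator (ball 0 1) v \<partial>lborel) \<le> emeasure lborel (ball (0::real^3) 1)"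
  proof (rule nn_integral_unit_ball_le [where a = "\<lambda>t. cos t *\<^sub>R axis 1 1 + sin t *\<^sub>R axis 2 1"
        and b = "\<lambda>t. - sin t *\<^sub>R axis 1 1 + cos t *\<^sub>R axis 2 1"])
    show "\<Psi> \<in> borel_measurable borel"
      unfolding \<Psi>_def
      by (intro measurable_compose [OF _ measurable_ennreal] borel_measurable_divide borel_measurable_continuous_onI
          continuous_intros)
    fix v :: "real^3"
    define R where "R = sqrt ((v$1)\<^sup>2 + (v$2)\<^sup>2)"
    let ?h = "\<lambda>t. k * \<bar>- v$1 * sin t + v$2 * cos t\<bar> / (1 + (k * (v$1 * cos t + v$2 * sin t))\<^sup>2)"
    have R: "0 \<le> R"
      by (simp add: R_def)
    obtain \<phi> where \<phi>: "0 \<le> \<phi>" "\<phi> \<le> 2 * pi" "v$1 = R * cos \<phi>" "v$2 = R * sin \<phi>"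
      by (rule polar_coordinates_real [of "v$1" "v$2", folded R_def]) (rule that)
    have "v$1 * cos t + v$2 * sin t = R * cos (t - \<phi>)" "- v$1 * sin t + v$2 * cos t = - (R * sin (t - \<phi>))" for t
      unfolding \<phi>(3,4) by (simp_all add: cos_diff sin_diff algebra_simps)
    then have h: "?h = (\<lambda>t. k * \<bar>- (R * sin (t - \<phi>))\<bar> / (1 + (k * (R * cos (t - \<phi>)))\<^sup>2))"
      by simp
    note cont = arctan_wave_integral_le(1) [OF \<open>0 \<le> k\<close> R]
    have "integral {0..2 * pi} ?h = integral {0..2 * pi} (\<lambda>s. k * \<bar>- (R * sin s)\<bar> / (1 + (k * (R * cos s))\<^sup>2))"
      unfolding h by (rule integral_phase_shift [OF cont _ \<phi>(1,2)]) simp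
    also have "\<dots> \<le> 2 * pi"
      by (rule arctan_wave_integral_le(2) [OF \<open>0 \<le> k\<close> R])
    finally have le: "integral {0..2 * pi} ?h \<le> 2 * pi" .
    have "continuous_on {0..2 * pi} ?h"
      unfolding h by (rule continuous_on_compose2 [OF cont]) (auto intro: continuous_intros)
    then have "(?h has_integral integral {0..2 * pi} ?h) {0..2 * pi}"
      by (intro integrable_integral integrable_continuous_interval)
    moreover have "0 \<le> ?h t" for t
      using \<open>0 \<le> k\<close> by simp
    ultimately have "(\<integral>\<^sup>+t. ennreal (?h t) * indicator {0..2 * pi} t \<partial>lborel) = ennreal (integral {0..2 * pi} ?h)"
      by (intro nn_integral_has_integral_lebesgue')
    also have "\<dots> \<le> ennreal (2 * pi)"
      using le by (rule ennreal_leI)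
    finally show "(\<integral>\<^sup>+t. \<Psi> ((cos t *\<^sub>R axis 1 1 + sin t *\<^sub>R axis 2 1) \<bullet> v, (- sin t *\<^sub>R axis 1 1 + cos t *\<^sub>R axis 2 1) \<bullet> v, norm v)
        * indicator {0..2 * pi} t \<partial>lborel) \<le> ennreal (2 * pi)"
      by (simp add: \<Psi>_def inner_add_left inner_diff_left inner_axis' mult.commute)
  qed (use assms in \<open>auto intro!: continuous_intros simp: norm_eq_1 inner_add_left inner_add_right inner_diff_left inner_diff_right inner_axis_axis power2_eq_square [symmetric]\<close>)
  then show ?thesis
    by (simp add: \<Psi>_def)
qed

subsection \<open>Averages over all projection directions\<close>

context unit_frame
begin

lemma T_dot_B: "T t \<bullet> B t = 0"
proof -
  have "norm (T' t) * (T t \<bullet> B t) = 0"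
    by (metis cross_T_T' dot_cross_self(1) inner_scaleR_right)
  then show ?thesis
    using T'_nonzero by simp
qed

lemma B_dot_B': "B t \<bullet> B' t = 0"
proof -
  have "((\<lambda>t. B t \<bullet> B t) has_vector_derivative B t \<bullet> B' t + B' t \<bullet> B t) (at t)"
    by (rule bounded_bilinear.has_vector_derivative [OF bounded_bilinear_inner has_derivative_B has_derivative_B])
  moreover have "(\<lambda>t. B t \<bullet> B t) = (\<lambda>t. 1)"
    by (simp add: dot_square_norm norm_B)
  ultimately have "((\<lambda>t. 1 :: real) has_vector_derivative 2 * (B t \<bullet> B' t)) (at t)"
    by (simp add: inner_commute)
  then have "2 * (B t \<bullet> B' t) = 0"
    using vector_derivative_unique_at has_vector_derivative_const by blast
  then show ?thesis
    by simp
qed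

lemma turning_density_average:
  "(\<integral>\<^sup>+v. ennreal (turning_density v t) * indicator (ball 0 1) v \<partial>lborel)
    \<le> ennreal (norm (T' t)) * emeasure lborel (ball (0::real^3) 1)"
proof -
  have "(\<integral>\<^sup>+v. ennreal (turning_density v t) * indicator (ball 0 1) v \<partial>lborel)
      = (\<integral>\<^sup>+v. ennreal (norm (T' t)) * (ennreal (\<bar>B t \<bullet> v\<bar> * norm v / ((norm v)\<^sup>2 - (T t \<bullet> v)\<^sup>2)) * indicator (ball 0 1) v) \<partial>lborel)"
    by (simp only: turning_density_def ennreal_mult' [OF norm_ge_zero] mult.assoc)
  also have "\<dots> = ennreal (norm (T' t)) * (\<integral>\<^sup>+v. ennreal (\<bar>B t \<bullet> v\<bar> * norm v / ((norm v)\<^sup>2 - (T t \<bullet> v)\<^sup>2)) * indicator (ball 0 1) v \<partial>lborel)"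
    by (rule nn_integral_cmult) (measurable, simp)
  also have "\<dots> \<le> ennreal (norm (T' t)) * emeasure lborel (ball (0::real^3) 1)"
    by (intro mult_left_mono turning_average_le norm_T norm_B T_dot_B) simp
  finally show ?thesis .
qed

lemma swing_density_average:
  assumes "0 \<le> k"
  shows "(\<integral>\<^sup>+v. ennreal (swing_density k v t) * indicator (ball 0 1) v \<partial>lborel)
    \<le> ennreal (norm (B' t)) * emeasure lborel (ball (0::real^3) 1)"
proof (cases "B' t = 0")
  case True
  then show ?thesis
    by (simp add: swing_density_def)
next
  case False
  define n where "n = B' t /\<^sub>R norm (B' t)"
  have n: "norm n = 1" "B t \<bullet> n = 0"
    using False by (simp_all add: n_def B_dot_B')
  have "\<bar>B' t \<bullet> v\<bar> = norm (B' t) * \<bar>n \<bullet> v\<bar>" for v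
    using False by (simp add: n_def abs_mult)
  then have "swing_density k v t = norm (B' t) * (k * \<bar>n \<bullet> v\<bar> / (1 + (k * (B t \<bullet> v))\<^sup>2))" for v
    by (simp add: swing_density_def)
  then have "(\<integral>\<^sup>+v. ennreal (swing_density k v t) * indicator (ball 0 1) v \<partial>lborel)
      = (\<integral>\<^sup>+v. ennreal (norm (B' t)) * (ennreal (k * \<bar>n \<bullet> v\<bar> / (1 + (k * (B t \<bullet> v))\<^sup>2)) * indicator (ball 0 1) v) \<partial>lborel)"
    by (simp only: ennreal_mult' [OF norm_ge_zero] mult.assoc)
  also have "\<dots> = ennreal (norm (B' t)) * (\<integral>\<^sup>+v. ennreal (k * \<bar>n \<bullet> v\<bar> / (1 + (k * (B t \<bullet> v))\<^sup>2)) * indicator (ball 0 1) v \<partial>lborel)"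
    by (rule nn_integral_cmult) (measurable, simp)
  also have "\<dots> \<le> ennreal (norm (B' t)) * emeasure lborel (ball (0::real^3) 1)"
    by (intro mult_left_mono swing_average_le norm_B n assms) simp
  finally show ?thesis .
qed

section \<open>Measurability and the average of the total density\<close>

lemma measurable_turning_density: "(\<lambda>x. turning_density (fst x) (snd x)) \<in> borel_measurable borel"
  unfolding turning_density_def
  by (intro borel_measurable_times borel_measurable_divide; intro borel_measurable_continuous_onI continuous_intros
      continuous_on_compose2 [OF continuous_T [of UNIV]] continuous_on_compose2 [OF continuous_B [of UNIV]]
      continuous_on_compose2 [OF continuous_T']) auto

lemma measurable_swing_density: "(\<lambda>x. swing_density k (fst x) (snd x)) \<in> borel_measurable borel"
  unfolding swing_density_def
  by (intro borel_measurable_divide; intro borel_measurable_continuous_onI continuous_intros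
      continuous_on_compose2 [OF continuous_B [of UNIV]] continuous_on_compose2 [OF continuous_B']) auto

lemma measurable_total_density: "(\<lambda>x. total_density k (fst x) (snd x)) \<in> borel_measurable borel"
  unfolding total_density_def
  by (intro borel_measurable_add measurable_turning_density measurable_swing_density)

lemma measurable_total_density_window:
  "(\<lambda>(v, t). ennreal (total_density k v t) * indicator {0..2 * pi} t) \<in> borel_measurable (lborel \<Otimes>\<^sub>M lborel)"
proof -
  have "(\<lambda>x. ennreal (total_density k (fst x) (snd x)) * indicator {0..2 * pi} (snd x)) \<in> borel_measurable borel"
    by (intro borel_measurable_times_ennreal measurable_compose [OF measurable_total_density measurable_ennreal]
        measurable_indicator_snd) simp
  then show ?thesis
    by (simp add: lborel_prod case_prod_unfold)
qed

text \<open>After exchanging the integrals, the averages over \<open>v\<close> at a fixed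
  \<open>t\<close> cost at most \<open>norm (T' t)\<close> for turning and
  \<open>norm (B' t)\<close> for swing, times the volume of the ball. The bound is the same for all
  \<open>k\<close>.\<close>

lemma total_density_average:
  "(\<integral>\<^sup>+v. (\<integral>\<^sup>+t. ennreal (total_density k v t) * indicator {0..2 * pi} t \<partial>lborel) * indicator (ball 0 1) v \<partial>lborel)
    \<le> ennreal (integral {0..2 * pi} (\<lambda>t. norm (T' t) + norm (B' t))) * emeasure lborel (ball (0::real^3) 1)"
    (is "_ \<le> _ * ?V")
proof -
  have meas: "(\<lambda>(v, t). ennreal (total_density k v t) * indicator {0..2 * pi} t * indicator (ball 0 1) v)
      \<in> borel_measurable (lborel \<Otimes>\<^sub>M lborel)"
  proof -
    have "(\<lambda>x. ennreal (total_density k (fst x) (snd x)) * indicator {0..2 * pi} (snd x) * indicator (ball 0 1) (fst x))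
        \<in> borel_measurable borel"
      by (intro borel_measurable_times_ennreal measurable_compose [OF measurable_total_density measurable_ennreal]
          measurable_indicator_snd measurable_indicator_fst) simp_all
    then show ?thesis
      by (simp add: lborel_prod case_prod_unfold)
  qed
  have "(\<integral>\<^sup>+v. (\<integral>\<^sup>+t. ennreal (total_density k v t) * indicator {0..2 * pi} t \<partial>lborel) * indicator (ball 0 1) v \<partial>lborel)
      = (\<integral>\<^sup>+v. (\<integral>\<^sup>+t. ennreal (total_density k v t) * indicator {0..2 * pi} t * indicator (ball 0 1) v \<partial>lborel) \<partial>lborel)"
    by (intro nn_integral_cong) (auto simp: indicator_def)
  also have "\<dots> = (\<integral>\<^sup>+t. (\<integral>\<^sup>+v. ennreal (total_density k v t) * indicator {0..2 * pi} t * indicator (ball 0 1) v \<partial>lborel) \<partial>lborel)"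
    by (rule lborel_pair.Fubini' [OF meas, symmetric])
  also have "\<dots> \<le> (\<integral>\<^sup>+t. ennreal (norm (T' t) + norm (B' t)) * indicator {0..2 * pi} t * ?V \<partial>lborel)"
  proof (rule nn_integral_mono)
    fix t
    have m: "(\<lambda>v. ennreal (turning_density v t) * indicator (ball 0 1) v) \<in> borel_measurable borel"
      "(\<lambda>v. ennreal (swing_density (real k) v t) * indicator (ball 0 1) v) \<in> borel_measurable borel"
      unfolding turning_density_def swing_density_def by (measurable, simp)+
    have "(\<integral>\<^sup>+v. ennreal (total_density k v t) * indicator (ball 0 1) v \<partial>lborel)
        = (\<integral>\<^sup>+v. ennreal (turning_density v t) * indicator (ball 0 1) v + ennreal (swing_density (real k) v t) * indicator (ball 0 1) v \<partial>lborel)"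
      by (simp add: total_density_def turning_density_nonneg swing_density_nonneg ennreal_plus distrib_right)
    also have "\<dots> = (\<integral>\<^sup>+v. ennreal (turning_density v t) * indicator (ball 0 1) v \<partial>lborel)
        + (\<integral>\<^sup>+v. ennreal (swing_density (real k) v t) * indicator (ball 0 1) v \<partial>lborel)"
      using m by (intro nn_integral_add) simp_all
    also have "\<dots> \<le> ennreal (norm (T' t)) * ?V + ennreal (norm (B' t)) * ?V"
      by (intro add_mono turning_density_average swing_density_average) simp
    also have "\<dots> = ennreal (norm (T' t) + norm (B' t)) * ?V"
      by (simp add: distrib_right)
    finally have "(\<integral>\<^sup>+v. ennreal (total_density k v t) * indicator (ball 0 1) v \<partial>lborel) \<le> ennreal (norm (T' t) + norm (B' t)) * ?V" .
    then show "(\<integral>\<^sup>+v. ennreal (total_density k v t) * indicator {0..2 * pi} t * indicator (ball 0 1) v \<partial>lborel)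
        \<le> ennreal (norm (T' t) + norm (B' t)) * indicator {0..2 * pi} t * ?V"
      by (cases "t \<in> {0..2 * pi}") simp_all
  qed
  also have "\<dots> = (\<integral>\<^sup>+t. ennreal (norm (T' t) + norm (B' t)) * indicator {0..2 * pi} t \<partial>lborel) * ?V"
  proof (rule nn_integral_multc)
    have "(\<lambda>t. norm (T' t) + norm (B' t)) \<in> borel_measurable borel"
      by (intro borel_measurable_continuous_onI continuous_intros continuous_T' continuous_B')
    then show "(\<lambda>t. ennreal (norm (T' t) + norm (B' t)) * indicator {0..2 * pi} t) \<in> borel_measurable lborel"
      by measurable
  qed
  also have "(\<integral>\<^sup>+t. ennreal (norm (T' t) + norm (B' t)) * indicator {0..2 * pi} t \<partial>lborel)
      = ennreal (integral {0..2 * pi} (\<lambda>t. norm (T' t) + norm (B' t)))"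
    by (intro nn_integral_has_integral_lebesgue' integrable_integral integrable_continuous_interval continuous_intros
        continuous_on_subset [OF continuous_T'] continuous_on_subset [OF continuous_B']) simp_all
  finally show ?thesis .
qed

lemma integral_frame_speed_nonneg: "0 \<le> integral {0..2 * pi} (\<lambda>t. norm (T' t) + norm (B' t))"
  by (intro integral_nonneg integrable_continuous_interval continuous_intros
      continuous_on_subset [OF continuous_T'] continuous_on_subset [OF continuous_B']) simp_all

text \<open>The directions that are not transversal lie on the cone over the tangent curve, the
  image of a plane under a differentiable map into space, which is a null set. Those orthogonal to
  \<open>B 0\<close> form a plane.\<close>

lemma AE_transversal: "AE v in lborel. transversal v \<and> B 0 \<bullet> v \<noteq> 0"
proof -
  define S where "S = (\<lambda>(x :: real \<times> real). snd x *\<^sub>R T (fst x)) ` UNIV"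
  have "negligible S"
    unfolding S_def
  proof (rule negligible_differentiable_image_lowdim)
    have "((\<lambda>x. T (fst x)) has_derivative (\<lambda>h. fst h *\<^sub>R T' (fst x))) (at x)" for x :: "real \<times> real"
      by (rule has_derivative_compose [OF has_derivative_fst [OF has_derivative_ident] has_derivative_T [unfolded has_vector_derivative_def]])
    then show "(\<lambda>x :: real \<times> real. snd x *\<^sub>R T (fst x)) differentiable_on UNIV"
      unfolding differentiable_on_def differentiable_def
      by (auto intro!: exI derivative_eq_intros)
  qed simp
  moreover have "negligible {v. B 0 \<bullet> v = 0}"
    using norm_B [of 0] by (intro negligible_hyperplane) auto
  ultimately have "negligible (S \<union> {v. B 0 \<bullet> v = 0})"
    by (rule negligible_Un)
  then have "AE v in lebesgue. v \<notin> S \<union> {v. B 0 \<bullet> v = 0}"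
    by (intro AE_not_in) (simp add: negligible_iff_null_sets)
  then have "AE v in lborel. v \<notin> S \<union> {v. B 0 \<bullet> v = 0}"
    by (simp add: AE_completion_iff)
  then show ?thesis
  proof (rule AE_mp, intro AE_I2 impI conjI)
    fix v assume v: "v \<notin> S \<union> {v. B 0 \<bullet> v = 0}"
    then show "B 0 \<bullet> v \<noteq> 0"
      by simp
    show "transversal v"
      unfolding transversal_def
    proof (intro allI notI)
      fix t assume eq: "(norm v)\<^sup>2 = (T t \<bullet> v)\<^sup>2"
      \<comment> \<open>Equality in Cauchy-Schwarz: the part of \<open>v\<close> orthogonal to
        \<open>T t\<close> vanishes.\<close>
      have "norm (v - (T t \<bullet> v) *\<^sub>R T t) ^ 2 = (norm v)\<^sup>2 - (T t \<bullet> v)\<^sup>2"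
        using norm_T [of t] unfolding power2_norm_eq_inner norm_eq_1
        by (simp add: inner_diff_left inner_diff_right inner_commute power2_eq_square)
      then have "v = (T t \<bullet> v) *\<^sub>R T t"
        using eq by simp
      then have "v \<in> S"
        unfolding S_def by (intro image_eqI [of _ _ "(t, T t \<bullet> v)"]) auto
      then show False
        using v by simp
    qed
  qed
qed

end

section \<open>Choice of the projection direction\<close>

context closed_frame
begin

text \<open>If every direction failed, then for almost every \<open>v\<close> the integrated density
  would be at least \<open>c\<close> for all large \<open>k\<close>, with a single constant
  \<open>c > L\<close>. Fatou's lemma would then contradict the average bound. The constant can be
  uniform because the counts are integers.\<close>

lemma exists_direction_bounding_local_maxima:
  defines "L \<equiv> integral {0..2 * pi} (\<lambda>t. norm (T' t) + norm (B' t))"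
  obtains u where "norm u = 1"
    and "\<And>w \<A>. \<lbrakk>norm w = 1; w \<bullet> u = 0; finite \<A>; \<A> \<subseteq> local_max_arcs w \<gamma>\<rbrakk> \<Longrightarrow> 2 * pi * real (card \<A>) \<le> L"
proof (rule ccontr)
  note direction = that
  assume no: "\<not> thesis"
  have bad: "\<exists>w \<A>. norm w = 1 \<and> w \<bullet> u = 0 \<and> finite \<A> \<and> \<A> \<subseteq> local_max_arcs w \<gamma> \<and> L < 2 * pi * real (card \<A>)"
    if "norm u = 1" for u
    using direction [OF that] no by (meson not_less)
  \<comment> \<open>The least integer with \<open>L < 2 * pi * N\<close>; every count that violates
    the bound is at least \<open>N\<close>.\<close>
  define N where "N = nat \<lfloor>L / (2 * pi)\<rfloor> + 1"
  have "0 \<le> L"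
    unfolding L_def by (rule integral_frame_speed_nonneg)
  then have "L / (2 * pi) < real N"
    unfolding N_def by (simp add: nat_add_distrib) linarith
  then have N: "L < 2 * pi * real N"
    by (simp add: field_simps)
  have N_le: "N \<le> n" if "L < 2 * pi * real n" for n
  proof -
    have "L / (2 * pi) < real n"
      using that by (simp add: field_simps)
    then have "\<lfloor>L / (2 * pi)\<rfloor> < int n"
      by linarith
    then show ?thesis
      using \<open>0 \<le> L\<close> by (simp add: N_def nat_less_iff Suc_le_eq)
  qed
  \<comment> \<open>Halfway between \<open>L\<close> and \<open>2 * pi * N\<close>: half of the gap
    is spent as the loss \<open>\<delta>\<close>, the other half keeps \<open>c\<close> above
    \<open>L\<close>.\<close>
  define c where "c = (2 * pi * real N + L) / 2"
  have c: "L < c" "0 < c"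
    using N \<open>0 \<le> L\<close> by (simp_all add: c_def)
  define F where "F k v = (\<integral>\<^sup>+t. ennreal (total_density k v t) * indicator {0..2 * pi} t \<partial>lborel)" for k v
  let ?V = "emeasure lborel (ball (0::real^3) 1)"
  have F_eq: "F k v = ennreal (integral {0..2 * pi} (total_density k v))" if "transversal v" for k v
    unfolding F_def using that
    by (intro nn_integral_has_integral_lebesgue' integrable_integral integrable_continuous_interval
        continuous_total_density total_density_nonneg)
  have F_meas: "F k \<in> borel_measurable lborel" for k
    unfolding F_def [abs_def] by (rule lborel.borel_measurable_nn_integral [OF measurable_total_density_window])
  have liminf_F: "ennreal c \<le> liminf (\<lambda>k. F k v)" if v: "transversal v" "B 0 \<bullet> v \<noteq> 0" for v
  proof -
    have vnz: "v \<noteq> 0"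
      using v by auto
    then have "norm (v /\<^sub>R norm v) = 1"
      by simp
    then obtain w \<A> where w: "norm w = 1" "w \<bullet> (v /\<^sub>R norm v) = 0" "finite \<A>" "\<A> \<subseteq> local_max_arcs w \<gamma>"
        and card: "L < 2 * pi * real (card \<A>)"
      using bad by blast
    have "w \<bullet> v = 0"
      using w(2) vnz by simp
    moreover have "0 < (2 * pi * real N - L) / 2"
      using N by simp
    ultimately have "\<forall>\<^sub>F k in sequentially. 2 * pi * real (card \<A>) - (2 * pi * real N - L) / 2 \<le> integral {0..2 * pi} (total_density k v)"
      using card_local_max_arcs_le [OF v w(1) _ w(3,4)] by blast
    moreover have c_le: "c \<le> 2 * pi * real (card \<A>) - (2 * pi * real N - L) / 2"
      using N_le [OF card] by (simp add: c_def field_simps)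
    ultimately have "\<forall>\<^sub>F k in sequentially. ennreal c \<le> F k v"
      by (auto simp: F_eq [OF v(1)] elim!: eventually_mono intro!: ennreal_leI)
    then show ?thesis
      by (rule Liminf_bounded)
  qed
  have "ennreal c * ?V = (\<integral>\<^sup>+v. ennreal c * indicator (ball 0 1) (v::real^3) \<partial>lborel)"
    by (subst nn_integral_cmult_indicator) simp_all
  also have "\<dots> \<le> (\<integral>\<^sup>+v. liminf (\<lambda>k. F k v * indicator (ball 0 1) v) \<partial>lborel)"
  proof (rule nn_integral_mono_AE)
    show "AE v in lborel. ennreal c * indicator (ball 0 1) v \<le> liminf (\<lambda>k. F k v * indicator (ball 0 1) v)"
      using AE_transversal
    proof eventually_elim
      case (elim v)
      then show ?case
        using liminf_F [of v] by (cases "v \<in> ball 0 1") auto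
    qed
  qed
  \<comment> \<open>Fatou's lemma.\<close>
  also have "\<dots> \<le> liminf (\<lambda>k. \<integral>\<^sup>+v. F k v * indicator (ball 0 1) v \<partial>lborel)"
    by (intro nn_integral_liminf borel_measurable_times_ennreal F_meas borel_measurable_indicator) simp
  also have "\<dots> \<le> limsup (\<lambda>k. \<integral>\<^sup>+v. F k v * indicator (ball 0 1) v \<partial>lborel)"
    by (rule Liminf_le_Limsup) simp
  also have "\<dots> \<le> ennreal L * ?V"
    using total_density_average by (intro Limsup_bounded always_eventually) (simp add: F_def L_def)
  finally have "?V * ennreal c \<le> ?V * ennreal L"
    by (simp add: mult.commute)
  moreover have "?V \<noteq> 0"
    using content_ball_pos [of 1 "0 :: real^3"] by (auto simp: measure_def)
  moreover have "?V \<noteq> top"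
    using emeasure_lborel_ball_finite [of "0 :: real^3" 1] by auto
  ultimately have "ennreal c \<le> ennreal L"
    by (simp add: ennreal_mult_le_mult_iff)
  then show False
    using c by (simp add: ennreal_le_iff2)
qed

end

subsection \<open>The Frenet frame\<close>

text \<open>The derivative predicates at the two points are equivalent, so
  \<open>vector_derivative\<close> chooses the same value at both, also where no derivative
  exists.\<close>

lemma vderiv_shift:
  assumes "\<And>t. f (t + p) = f t"
  shows "vderiv f (t + p) = vderiv f t"
proof -
  have "(f has_vector_derivative D) (at (t + p)) \<longleftrightarrow> (f has_vector_derivative D) (at t)" for D
  proof
    assume "(f has_vector_derivative D) (at (t + p))"
    then have "((f \<circ> (\<lambda>t. t + p)) has_vector_derivative 1 *\<^sub>R D) (at t)"
      by (intro vector_diff_chain_at) (auto intro!: derivative_eq_intros)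
    then show "(f has_vector_derivative D) (at t)"
      using assms by (simp add: o_def)
  next
    assume "(f has_vector_derivative D) (at t)"
    then have "((f \<circ> (\<lambda>t. t - p)) has_vector_derivative 1 *\<^sub>R D) (at (t + p))"
      by (intro vector_diff_chain_at) (auto intro!: derivative_eq_intros)
    moreover have "f (t - p) = f t" for t
      using assms [of "t - p"] by simp
    ultimately show "(f has_vector_derivative D) (at (t + p))"
      by (simp add: o_def)
  qed
  then show ?thesis
    by (simp add: vderiv_def vector_derivative_def)
qed

lemma smooth_has_vector_derivative:
  assumes "smooth f"
  shows "((vderiv ^^ n) f has_vector_derivative (vderiv ^^ Suc n) f t) (at t)"
  using assms by (simp add: smooth_def vderiv_def vector_derivative_works)

lemma has_vector_derivative_normalize:
  fixes F :: "real \<Rightarrow> real^3"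
  assumes F: "(F has_vector_derivative F') (at t)" and nz: "F t \<noteq> 0"
  shows "((\<lambda>t. F t /\<^sub>R norm (F t)) has_vector_derivative
    F' /\<^sub>R norm (F t) - ((F t \<bullet> F') / norm (F t) ^ 3) *\<^sub>R F t) (at t)"
proof -
  have inner: "((\<lambda>t. F t \<bullet> F t) has_real_derivative 2 * (F t \<bullet> F')) (at t)"
    using bounded_bilinear.has_vector_derivative [OF bounded_bilinear_inner F F]
    by (simp add: has_real_derivative_iff_has_vector_derivative inner_commute)
  have pos: "0 < F t \<bullet> F t"
    using nz by simp
  have "((\<lambda>t. inverse (sqrt (F t \<bullet> F t))) has_real_derivative
      - (inverse (sqrt (F t \<bullet> F t)) * (inverse (sqrt (F t \<bullet> F t)) / 2 * (2 * (F t \<bullet> F'))) * inverse (sqrt (F t \<bullet> F t)))) (at t)"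
    using pos by (auto intro!: derivative_eq_intros inner simp: leD [OF inner_ge_zero])
  then have "((\<lambda>t. inverse (norm (F t))) has_vector_derivative - ((F t \<bullet> F') / norm (F t) ^ 3)) (at t)"
    using nz by (simp add: norm_eq_sqrt_inner [symmetric] has_real_derivative_iff_has_vector_derivative power3_eq_cube field_simps)
  then have "((\<lambda>t. inverse (norm (F t)) *\<^sub>R F t) has_vector_derivative
      inverse (norm (F t)) *\<^sub>R F' + (- ((F t \<bullet> F') / norm (F t) ^ 3)) *\<^sub>R F t) (at t)"
    by (intro bounded_bilinear.has_vector_derivative [OF bounded_bilinear_scaleR] F)
  then show ?thesis
    by simp
qed

lemma has_vector_derivative_cross3:
  assumes "(F has_vector_derivative F') (at t)" "(G has_vector_derivative G') (at t)"
  shows "((\<lambda>t. cross3 (F t) (G t)) has_vector_derivative cross3 (F t) G' + cross3 F' (G t)) (at t)"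
  using bounded_bilinear.has_vector_derivative [OF _ assms] bilinear_conv_bounded_bilinear bilinear_cross by blast

text \<open>Tangent and binormal are the normalizations of the first derivative and of the cross
  product \<open>b\<close> of the first two derivatives. This yields explicit continuous
  derivatives. The derivative of the binormal is a multiple of the principal normal, so its norm is
  the absolute torsion times the speed.\<close>

lemma frenet_frame:
  assumes f: "frenet_curve f"
  obtains T' B' where
    "\<And>t. (unit_tangent f has_vector_derivative T' t) (at t)"
    "\<And>t. (binormal f has_vector_derivative B' t) (at t)"
    "continuous_on UNIV T'" "continuous_on UNIV B'"
    "\<And>t. norm (unit_tangent f t) = 1" "\<And>t. norm (binormal f t) = 1"
    "\<And>t. cross3 (unit_tangent f t) (T' t) = norm (T' t) *\<^sub>R binormal f t"
    "\<And>t. T' t \<noteq> 0"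
    "\<And>t. T' t = vderiv (unit_tangent f) t" "\<And>t. B' t = vderiv (binormal f) t"
    "\<And>t. (curvature f t + \<bar>torsion f t\<bar>) * norm (vderiv f t) = norm (T' t) + norm (B' t)"
proof -
  have sm: "smooth f" and reg: "\<And>t. vderiv f t \<noteq> 0" and curv: "\<And>t. curvature f t \<noteq> 0"
    using f by (auto simp: frenet_curve_def)
  define f1 f2 f3 where "f1 = vderiv f" and "f2 = vderiv f1" and "f3 = vderiv f2"
  have d1: "(f1 has_vector_derivative f2 t) (at t)" and d2: "(f2 has_vector_derivative f3 t) (at t)" for t
    using smooth_has_vector_derivative [OF sm, of 1 t] smooth_has_vector_derivative [OF sm, of 2 t]
    by (simp_all add: f1_def f2_def f3_def numeral_2_eq_2)
  have d3: "(f3 has_vector_derivative vderiv f3 t) (at t)" for t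
    using smooth_has_vector_derivative [OF sm, of 3 t]
    by (simp add: f1_def f2_def f3_def numeral_3_eq_3)
  have c: "continuous_on UNIV f1" "continuous_on UNIV f2" "continuous_on UNIV f3"
    using has_vector_derivative_continuous [OF d1] has_vector_derivative_continuous [OF d2]
      has_vector_derivative_continuous [OF d3] by (simp_all add: continuous_at_imp_continuous_on)
  let ?T = "unit_tangent f"
  have T: "?T = (\<lambda>t. f1 t /\<^sub>R norm (f1 t))"
    by (simp add: unit_tangent_def f1_def fun_eq_iff)
  have nz1: "f1 t \<noteq> 0" for t
    by (simp add: f1_def reg)
  define T' where "T' t = f2 t /\<^sub>R norm (f1 t) - ((f1 t \<bullet> f2 t) / norm (f1 t) ^ 3) *\<^sub>R f1 t" for t
  have dT: "(?T has_vector_derivative T' t) (at t)" for t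
    unfolding T T'_def by (rule has_vector_derivative_normalize [OF d1 nz1])
  then have vT: "vderiv ?T t = T' t" for t
    unfolding vderiv_def by (rule vector_derivative_at)
  have nT: "norm (?T t) = 1" for t
    using nz1 by (simp add: T)
  have nzT': "T' t \<noteq> 0" for t
    using curv [of t] by (auto simp: curvature_def vT)
  have cT': "continuous_on UNIV T'"
    unfolding T'_def using nz1 by (intro continuous_intros c) auto
  have TT': "?T t \<bullet> T' t = 0" for t
    using nz1 [of t] by (simp add: T T'_def inner_diff_right dot_square_norm power2_eq_square power3_eq_cube) (simp add: field_simps)
  define b where "b t = cross3 (f1 t) (f2 t)" for t
  \<comment> \<open>The tangential part of \<open>T'\<close> drops out of the cross product.\<close>
  have cr: "cross3 (?T t) (T' t) = (1 / (norm (f1 t))\<^sup>2) *\<^sub>R b t" for t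
    by (simp add: T T'_def b_def cross_mult_left cross_mult_right Cross3.right_diff_distrib power2_eq_square divide_inverse)
  have ncr: "norm (cross3 (?T t) (T' t)) = norm (T' t)" for t
    using norm_cross_dot [of "?T t" "T' t"] by (simp add: nT TT')
  have bnz: "b t \<noteq> 0" for t
    using ncr [of t] nzT' [of t] by (auto simp: cr)
  have Bdef: "binormal f t = cross3 (?T t) (T' t) /\<^sub>R norm (T' t)" for t
    by (simp add: binormal_def principal_normal_def vT cross_mult_right)
  have B: "binormal f = (\<lambda>t. b t /\<^sub>R norm (b t))"
  proof
    fix t
    have "norm (T' t) = norm (b t) / (norm (f1 t))\<^sup>2"
      using ncr [of t] by (simp add: cr)
    then show "binormal f t = b t /\<^sub>R norm (b t)"
      using nz1 [of t] by (simp add: Bdef cr inverse_eq_divide)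
  qed
  \<comment> \<open>The product rule has a second term, the cross product of \<open>f2 t\<close>
    with itself, which vanishes.\<close>
  define b' where "b' t = cross3 (f1 t) (f3 t)" for t
  have db: "(b has_vector_derivative b' t) (at t)" for t
    using has_vector_derivative_cross3 [OF d1 d2, of t] by (simp add: b_def [abs_def] b'_def)
  define B' where "B' t = b' t /\<^sub>R norm (b t) - ((b t \<bullet> b' t) / norm (b t) ^ 3) *\<^sub>R b t" for t
  have dB: "(binormal f has_vector_derivative B' t) (at t)" for t
    unfolding B B'_def by (rule has_vector_derivative_normalize [OF db bnz])
  then have vB: "vderiv (binormal f) t = B' t" for t
    unfolding vderiv_def by (rule vector_derivative_at)
  have cb: "continuous_on UNIV b" "continuous_on UNIV b'"
    unfolding b_def b'_def by (intro continuous_on_cross c)+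
  have cB': "continuous_on UNIV B'"
    unfolding B'_def using bnz by (intro continuous_intros cb) auto
  have nB: "norm (binormal f t) = 1" for t
    using bnz by (simp add: B)
  have cross: "cross3 (?T t) (T' t) = norm (T' t) *\<^sub>R binormal f t" for t
    using nzT' by (simp add: Bdef)
  have "norm (B' t) = \<bar>B' t \<bullet> principal_normal f t\<bar>" for t
  proof -
    let ?N = "principal_normal f t"
    have N: "?N = T' t /\<^sub>R norm (T' t)"
      by (simp add: principal_normal_def vT)
    have bb': "b t \<bullet> B' t = 0"
      using bnz [of t] by (simp add: B'_def inner_diff_right dot_square_norm power2_eq_square power3_eq_cube inverse_eq_divide)
    have f1b': "f1 t \<bullet> B' t = 0"
      by (simp add: B'_def b_def b'_def inner_diff_right dot_cross_self)
    have TB': "?T t \<bullet> B' t = 0"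
      by (simp add: T f1b')
    have BB': "cross3 (?T t) ?N \<bullet> B' t = 0"
      using bb' by (simp add: N cross_mult_right cr)
    \<comment> \<open>Gram's identity for the orthonormal pair of tangent and principal normal. The
      left side vanishes, since \<open>B'\<close> is orthogonal to the binormal, so only the normal
      component of \<open>B'\<close> remains.\<close>
    have "(B' t \<bullet> cross3 (?T t) ?N)\<^sup>2 = (B' t \<bullet> B' t) - (B' t \<bullet> ?N)\<^sup>2"
    proof -
      have "?T t \<bullet> ?T t = 1" "?N \<bullet> ?N = 1" "?T t \<bullet> ?N = 0"
        using nT [of t] nzT' [of t] TT' [of t] by (simp_all add: N dot_square_norm)
      moreover have "B' t \<bullet> ?T t = 0"
        using TB' by (simp add: inner_commute)
      ultimately show ?thesis
        by (simp add: Gram_cross3)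
    qed
    then have "(norm (B' t))\<^sup>2 = (B' t \<bullet> ?N)\<^sup>2"
      using BB' by (simp add: inner_commute dot_square_norm)
    from arg_cong [OF this, of sqrt] show ?thesis
      by simp
  qed
  then have "(curvature f t + \<bar>torsion f t\<bar>) * norm (vderiv f t) = norm (T' t) + norm (B' t)" for t
    using reg [of t] by (simp add: curvature_def torsion_def vT vB distrib_right)
  then show thesis
    by (rule that [OF dT dB cT' cB' nT nB cross nzT' vT [symmetric] vB [symmetric]])
qed

subsection \<open>The inequality\<close>

lemma closed_frame_of_frenet_curve:
  assumes \<gamma>: "continuous_on circle \<gamma>" and f: "frenet_curve (\<gamma> \<circ> cis)"
  obtains T B T' B' \<sigma> where "closed_frame T B T' B' \<gamma> \<sigma>"
    and "\<And>t. (curvature (\<gamma> \<circ> cis) t + \<bar>torsion (\<gamma> \<circ> cis) t\<bar>) * norm (vderiv (\<gamma> \<circ> cis) t)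
      = norm (T' t) + norm (B' t)"
proof -
  let ?f = "\<gamma> \<circ> cis"
  obtain T' B' where frame:
    "\<And>t. (unit_tangent ?f has_vector_derivative T' t) (at t)"
    "\<And>t. (binormal ?f has_vector_derivative B' t) (at t)"
    "continuous_on UNIV T'" "continuous_on UNIV B'"
    "\<And>t. norm (unit_tangent ?f t) = 1" "\<And>t. norm (binormal ?f t) = 1"
    "\<And>t. cross3 (unit_tangent ?f t) (T' t) = norm (T' t) *\<^sub>R binormal ?f t"
    "\<And>t. T' t \<noteq> 0"
    "\<And>t. T' t = vderiv (unit_tangent ?f) t" "\<And>t. B' t = vderiv (binormal ?f) t"
    and kt: "\<And>t. (curvature ?f t + \<bar>torsion ?f t\<bar>) * norm (vderiv ?f t) = norm (T' t) + norm (B' t)"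
    by (rule frenet_frame [OF f]) (rule that)
  have reg: "vderiv ?f t \<noteq> 0" for t
    using f by (simp add: frenet_curve_def)
  have "?f (t + 2 * pi) = ?f t" for t
    by (simp add: cis_mult [symmetric])
  then have "vderiv ?f (t + 2 * pi) = vderiv ?f t" for t
    by (rule vderiv_shift)
  then have T: "unit_tangent ?f (t + 2 * pi) = unit_tangent ?f t" for t
    by (simp add: unit_tangent_def)
  then have T': "vderiv (unit_tangent ?f) (t + 2 * pi) = vderiv (unit_tangent ?f) t" for t
    by (rule vderiv_shift)
  have B: "binormal ?f (t + 2 * pi) = binormal ?f t" for t
    by (simp add: binormal_def principal_normal_def T T')
  then have B': "vderiv (binormal ?f) (t + 2 * pi) = vderiv (binormal ?f) t" for t
    by (rule vderiv_shift)
  have "closed_frame (unit_tangent ?f) (binormal ?f) T' B' \<gamma> (\<lambda>t. norm (vderiv ?f t))"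
  proof unfold_locales
    show "((\<lambda>t. \<gamma> (cis t)) has_vector_derivative norm (vderiv ?f t) *\<^sub>R unit_tangent ?f t) (at t)" for t
      using smooth_has_vector_derivative [of ?f 0 t] f reg [of t]
      by (simp add: frenet_curve_def unit_tangent_def o_def)
    show "0 < norm (vderiv ?f t)" for t
      using reg by simp
  qed (use frame \<gamma> T T' B B' in auto)
  then show thesis
    using kt by (rule that)
qed

text \<open>Bounding finite subfamilies also excludes the value infinity: an infinite family would
  contain a subfamily of \<open>Suc n\<close> arcs.\<close>

lemma num_local_max_le:
  assumes "\<And>\<A>. \<lbrakk>finite \<A>; \<A> \<subseteq> local_max_arcs w \<gamma>\<rbrakk> \<Longrightarrow> card \<A> \<le> n"
  shows "num_local_max w \<gamma> \<le> enat n"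
proof -
  have "finite (local_max_arcs w \<gamma>)"
  proof (rule ccontr)
    assume "infinite (local_max_arcs w \<gamma>)"
    then obtain \<A> where "finite \<A>" "card \<A> = Suc n" "\<A> \<subseteq> local_max_arcs w \<gamma>"
      using infinite_arbitrarily_large by blast
    then show False
      using assms [of \<A>] by simp
  qed
  then show ?thesis
    using assms by (simp add: num_local_max_def)
qed

theorem theorem4p2:
  fixes K :: closed_curve
  assumes "simple_closed_curve K"
  shows "ereal (2 * pi) * ereal_of_enat (psb (knot_type K)) \<le> curvature_torsion (knot_type K)"
  unfolding curvature_torsion_def
proof (rule INF_greatest)
  \<comment> \<open>Each Frenet representative is treated separately; if there is none, the infimum
    is infinity.\<close>
  fix \<gamma> assume \<gamma>: "\<gamma> \<in> {\<gamma> \<in> knot_type K. frenet_curve (\<gamma> \<circ> cis)}"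
  let ?f = "\<gamma> \<circ> cis"
  let ?L = "integral {0..2 * pi} (\<lambda>t. (curvature ?f t + \<bar>torsion ?f t\<bar>) * norm (vderiv ?f t))"
  have "continuous_on circle \<gamma>" "frenet_curve ?f"
    using \<gamma> by (auto simp: knot_type_def simple_closed_curve_def)
  then obtain T B T' B' \<sigma> where "closed_frame T B T' B' \<gamma> \<sigma>"
      and L: "\<And>t. (curvature ?f t + \<bar>torsion ?f t\<bar>) * norm (vderiv ?f t) = norm (T' t) + norm (B' t)"
    by (rule closed_frame_of_frenet_curve) (rule that)
  then interpret closed_frame T B T' B' \<gamma> \<sigma>
    by simp
  obtain u where u: "norm u = 1"
    and le: "\<And>w \<A>. \<lbrakk>norm w = 1; w \<bullet> u = 0; finite \<A>; \<A> \<subseteq> local_max_arcs w \<gamma>\<rbrakk>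
      \<Longrightarrow> 2 * pi * real (card \<A>) \<le> integral {0..2 * pi} (\<lambda>t. norm (T' t) + norm (B' t))"
    by (rule exists_direction_bounding_local_maxima) (rule that)
  \<comment> \<open>The counts are integers, so the bound \<open>L / (2 * pi)\<close> on them may be
    rounded down.\<close>
  define n where "n = nat \<lfloor>?L / (2 * pi)\<rfloor>"
  have "0 \<le> ?L / (2 * pi)"
    unfolding L using integral_frame_speed_nonneg by simp
  then have "real n \<le> ?L / (2 * pi)"
    unfolding n_def by simp
  then have n: "2 * pi * real n \<le> ?L"
    by (simp add: field_simps)
  have "num_local_max w (proj u \<circ> \<gamma>) \<le> enat n" if "norm w = 1" "w \<bullet> u = 0" for w
  proof (rule num_local_max_le)
    fix \<A> assume "finite \<A>" "\<A> \<subseteq> local_max_arcs w (proj u \<circ> \<gamma>)"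
    then have "2 * pi * real (card \<A>) \<le> ?L"
      unfolding L using le that by (simp add: local_max_arcs_proj)
    then have "real (card \<A>) \<le> ?L / (2 * pi)"
      by (simp add: field_simps)
    then show "card \<A> \<le> n"
      unfolding n_def by (simp add: le_nat_floor)
  qed
  \<comment> \<open>The given representative and the direction \<open>u\<close> are admissible in
    the two infima of \<open>psb\<close>, and the bound \<open>n\<close> is independent of
    \<open>w\<close>.\<close>
  then have "psb (knot_type K) \<le> enat n"
    unfolding psb_def using \<gamma> u by (intro INF_lower2 [of \<gamma>] INF_lower2 [of u] SUP_least) auto
  then have "ereal (2 * pi) * ereal_of_enat (psb (knot_type K)) \<le> ereal (2 * pi) * ereal_of_enat (enat n)"
    by (intro ereal_mult_left_mono) (simp_all only: ereal_of_enat_le_iff, simp)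
  also have "\<dots> = ereal (2 * pi * real n)"
    by simp
  also have "\<dots> \<le> ereal ?L"
    using n by simp
  finally show "ereal (2 * pi) * ereal_of_enat (psb (knot_type K)) \<le> ereal ?L" .
qed

end
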